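(* Let $U_0\in (V_{N_g})^N\cap\mathcal M^N$ and let $U:[0,\infty)\to (V_{N_g})^N$ be a solution of the gradient flow $$\frac{\mathrm dU}{\mathrm dt}=-\nabla_G E(U),\quad 0<t<\infty,\qquad U(0)=U_0 .$$ Then $U(t)\in\mathcal M^N$ for all $t\ge 0$. Moreover, $$\frac{\mathrm d E(U(t))}{\mathrm dt}=-|||\nabla_G E(U(t))|||^2\le 0,\qquad 0<t<\infty .$$
   Context: Setting. $N\ge 1$; $V_{N_g}\subset H^1(\mathbb R^3)$ is a finite-dimensional space (dimension $N_g$) of real-valued functions. For $N$-tuples $\Psi=(\psi_1,\dots,\psi_N)$, $\Phi=(\varphi_1,\dots,\varphi_N)$ of functions, $\langle\Psi^\top\Phi\rangle=((\psi_i,\varphi_j)_{L^2(\mathbb R^3)})_{i,j=1}^N\in\mathbb R^{N\times N}$, $(\Psi,\Phi)=\mathrm{tr}\langle\Psi^\top\Phi\rangle$, $|||\Psi|||=(\Psi,\Psi)^{1/2}$. For $P\in\mathbb R^{N\times N}$, $UP$ is the $N$-tuple with $i$-th entry $\sum_j p_{ji}u_j$. $\mathcal M^N=\{U\in (H^1(\mathbb R^3))^N:\langle U^\top U\rangle=I_N\}$ (Stiefel manifold). Energy. $E$ is the Kohn-Sham energy $$E(U)=\sum_{i=1}^N\int_{\mathbb R^3}|\nabla u_i|^2\,dr+\int_{\mathbb R^3}V_{ext}\rho_U\,dr+\frac12\iint\frac{\rho_U(r)\rho_U(r')}{|r-r'|}\,dr\,dr'+\int_{\mathbb R^3}\varepsilon_{xc}(\rho_U)\rho_U\,dr,\qquad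 \rho_U=2\sum_{i=1}^N|u_i|^2,$$ where $V_{ext}$ is the external potential (for full potential calculations $V_{ext}(r)=-\sum_{I=1}^M Z_I/|r-R_I|$). The exchange-correlation term is assumed differentiable, with potential $v_{xc}(\rho)=\delta(\rho\,\varepsilon_{xc}(\rho))/\delta\rho$; thus $E$ is differentiable on $(V_{N_g})^N$, and $\nabla E(U)\in (V_{N_g})^N$ denotes its gradient with respect to $(\cdot,\cdot)$, i.e. for every $v\in V_{N_g}$ the $i$-th component satisfies $$((\nabla E(U))_i,v)_{L^2}=4\Big(\tfrac12(\nabla u_i,\nabla v)_{L^2}+(V_{ext}u_i,v)_{L^2}+\Big(\int\frac{\rho_U(r')}{|\cdot-r'|}dr'\,u_i,v\Big)_{L^2}+(v_{xc}(\rho_U)u_i,v)_{L^2}\Big).$$ In particular $\langle U^\top\nabla E(U)\rangle$ is a symmetric matrix. Extended Grassmann gradient. For $U\in (V_{N_g})^N$, $\nabla_G E(U)=\nabla E(U)\langle U^\top U\rangle-U\langle U^\top\nabla E(U)\rangle\in (V_{N_g})^N$. *)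

theory Defs
  imports "HOL-Analysis.Analysis"
begin

section \<open>The Hilbert space of square-integrable functions on three-dimensional space\<close>

definition L2_rel :: "(real^3 \<Rightarrow> real) \<Rightarrow> (real^3 \<Rightarrow> real) \<Rightarrow> bool" where
  "L2_rel f g \<longleftrightarrow>
     f \<in> borel_measurable lborel \<and> integrable lborel (\<lambda>r. (f r)\<^sup>2) \<and>
     g \<in> borel_measurable lborel \<and> integrable lborel (\<lambda>r. (g r)\<^sup>2) \<and>
     (AE r in lborel. f r = g r)"

lemma L2_rel_refl_iff:
  "L2_rel f f \<longleftrightarrow> f \<in> borel_measurable lborel \<and> integrable lborel (\<lambda>r. (f r)\<^sup>2)"
  by (auto simp: L2_rel_def)

quotient_type L2 = "real^3 \<Rightarrow> real" / partial: L2_rel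
proof (rule part_equivpI)
  show "\<exists>f. L2_rel f f"
    by (rule exI[of _ "\<lambda>_. 0"]) (simp add: L2_rel_def)
  show "symp L2_rel"
    unfolding symp_def L2_rel_def by (auto elim: AE_mp)
  show "transp L2_rel"
    unfolding transp_def L2_rel_def by auto
qed

lemma integrable_mult_square_integrable:
  fixes f g :: "real^3 \<Rightarrow> real"
  assumes "f \<in> borel_measurable lborel" "integrable lborel (\<lambda>r. (f r)\<^sup>2)"
    and "g \<in> borel_measurable lborel" "integrable lborel (\<lambda>r. (g r)\<^sup>2)"
  shows "integrable lborel (\<lambda>r. f r * g r)"
proof (rule Bochner_Integration.integrable_bound)
  show "integrable lborel (\<lambda>r. (f r)\<^sup>2 + (g r)\<^sup>2)"
    using assms by simp
  show "(\<lambda>r. f r * g r) \<in> borel_measurable lborel"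
    using assms by simp
  have "\<bar>x * y\<bar> \<le> x\<^sup>2 + y\<^sup>2" for x y :: real
  proof -
    have "2 * (\<bar>x\<bar> * \<bar>y\<bar>) \<le> x\<^sup>2 + y\<^sup>2"
      using sum_squares_bound[of "\<bar>x\<bar>" "\<bar>y\<bar>"] by (simp add: mult.assoc)
    moreover have "0 \<le> \<bar>x\<bar> * \<bar>y\<bar>" by simp
    ultimately show ?thesis unfolding abs_mult by linarith
  qed
  then show "AE r in lborel. norm (f r * g r) \<le> norm ((f r)\<^sup>2 + (g r)\<^sup>2)"
    by simp
qed

lemma square_integrable_add:
  fixes f g :: "real^3 \<Rightarrow> real"
  assumes "f \<in> borel_measurable lborel" "integrable lborel (\<lambda>r. (f r)\<^sup>2)"
    and "g \<in> borel_measurable lborel" "integrable lborel (\<lambda>r. (g r)\<^sup>2)"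
  shows "integrable lborel (\<lambda>r. (f r + g r)\<^sup>2)"
  using assms integrable_mult_square_integrable[OF assms]
  by (simp add: power2_sum mult.assoc)

instantiation L2 :: real_vector
begin

lift_definition zero_L2 :: L2 is "\<lambda>_. 0"
  by (simp add: L2_rel_def)

lift_definition plus_L2 :: "L2 \<Rightarrow> L2 \<Rightarrow> L2" is "\<lambda>f g r. f r + g r"
  unfolding L2_rel_def by (auto intro: square_integrable_add)

lift_definition uminus_L2 :: "L2 \<Rightarrow> L2" is "\<lambda>f r. - f r"
  unfolding L2_rel_def by auto

lift_definition scaleR_L2 :: "real \<Rightarrow> L2 \<Rightarrow> L2" is "\<lambda>c f r. c * f r"
  unfolding L2_rel_def by (auto simp: power_mult_distrib)

definition minus_L2 :: "L2 \<Rightarrow> L2 \<Rightarrow> L2" where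
  "minus_L2 u v = u + (- v)"

instance
proof
  fix a b :: real and u v w :: L2
  show "u + v + w = u + (v + w)"
    by transfer (auto simp: L2_rel_def add.assoc intro!: square_integrable_add)
  show "u + v = v + u"
    by transfer (auto simp: L2_rel_def add.commute intro: square_integrable_add)
  show "0 + u = u"
    by transfer (auto simp: L2_rel_def)
  show "- u + u = 0"
    by transfer (auto simp: L2_rel_def)
  show "u - v = u + - v"
    by (rule minus_L2_def)
  show "a *\<^sub>R (u + v) = a *\<^sub>R u + a *\<^sub>R v"
    by transfer (auto simp: L2_rel_def distrib_left power_mult_distrib
        intro!: square_integrable_add)
  show "(a + b) *\<^sub>R u = a *\<^sub>R u + b *\<^sub>R u"
    by transfer (auto simp: L2_rel_def distrib_right power_mult_distrib
        intro!: square_integrable_add)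
  show "a *\<^sub>R b *\<^sub>R u = (a * b) *\<^sub>R u"
    by transfer (auto simp: L2_rel_def mult.assoc power_mult_distrib)
  show "1 *\<^sub>R u = u"
    by transfer (auto simp: L2_rel_def)
qed

end

instantiation L2 :: real_inner
begin

lift_definition inner_L2 :: "L2 \<Rightarrow> L2 \<Rightarrow> real" is
  "\<lambda>f g. integral\<^sup>L lborel (\<lambda>r. f r * g r)"
  unfolding L2_rel_def by (auto intro!: integral_cong_AE)

definition norm_L2 :: "L2 \<Rightarrow> real" where
  "norm_L2 u = sqrt (inner u u)"

definition sgn_L2 :: "L2 \<Rightarrow> L2" where
  "sgn_L2 u = u /\<^sub>R norm u"

definition dist_L2 :: "L2 \<Rightarrow> L2 \<Rightarrow> real" where
  "dist_L2 u v = norm (u - v)"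

definition uniformity_L2 :: "(L2 \<times> L2) filter" where
  "uniformity_L2 = (INF e\<in>{0<..}. principal {(u, v). dist u v < e})"

definition open_L2 :: "L2 set \<Rightarrow> bool" where
  "open_L2 S \<longleftrightarrow> (\<forall>u\<in>S. \<forall>\<^sub>F (u', v) in uniformity. u' = u \<longrightarrow> v \<in> S)"

instance
proof
  fix a :: real and u v w :: L2
  show "dist u v = norm (u - v)" by (rule dist_L2_def)
  show "sgn u = u /\<^sub>R norm u" by (rule sgn_L2_def)
  show "uniformity = (INF e\<in>{0<..}. principal {(x, y). dist (x :: L2) y < e})"
    by (rule uniformity_L2_def)
  show "open S \<longleftrightarrow> (\<forall>u\<in>S. \<forall>\<^sub>F (u', v) in uniformity. u' = u \<longrightarrow> v \<in> S)" for S :: "L2 set"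
    by (rule open_L2_def)
  show "norm u = sqrt (inner u u)" by (rule norm_L2_def)
  show "inner u v = inner v u"
    by transfer (simp add: mult.commute)
  show "inner (u + v) w = inner u w + inner v w"
    by transfer
      (simp add: L2_rel_def distrib_right integrable_mult_square_integrable)
  show "inner (a *\<^sub>R u) v = a * inner u v"
    by transfer (simp add: mult.assoc)
  show "0 \<le> inner u u"
    by transfer simp
  show "inner u u = 0 \<longleftrightarrow> u = 0"
  proof transfer
    fix f assume "L2_rel f f"
    then have m: "f \<in> borel_measurable lborel" and i: "integrable lborel (\<lambda>r. f r * f r)"
      by (simp_all add: L2_rel_def power2_eq_square)
    have "integral\<^sup>L lborel (\<lambda>r. f r * f r) = 0 \<longleftrightarrow> (AE r in lborel. f r * f r = 0)"
      using i by (intro integral_nonneg_eq_0_iff_AE) auto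
    then show "integral\<^sup>L lborel (\<lambda>r. f r * f r) = 0 \<longleftrightarrow> L2_rel f (\<lambda>_. 0)"
      using m i by (simp add: L2_rel_def power2_eq_square)
  qed
qed

end


section \<open>The Sobolev space of order one\<close>

definition partial_deriv :: "3 \<Rightarrow> (real^3 \<Rightarrow> real) \<Rightarrow> real^3 \<Rightarrow> real" where
  "partial_deriv k f = (\<lambda>r. frechet_derivative f (at r) (axis k 1))"

fun Ck :: "nat \<Rightarrow> (real^3 \<Rightarrow> real) \<Rightarrow> bool" where
  "Ck 0 f \<longleftrightarrow> continuous_on UNIV f"
| "Ck (Suc m) f \<longleftrightarrow> f differentiable_on UNIV \<and> (\<forall>k. Ck m (partial_deriv k f))"

definition test_function :: "(real^3 \<Rightarrow> real) \<Rightarrow> bool" where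
  "test_function \<phi> \<longleftrightarrow> (\<forall>m. Ck m \<phi>) \<and> compact (closure {r. \<phi> r \<noteq> 0})"

definition has_weak_gradient :: "L2 \<Rightarrow> L2^3 \<Rightarrow> bool" where
  "has_weak_gradient u g \<longleftrightarrow>
     (\<forall>\<phi>. test_function \<phi> \<longrightarrow>
       (\<forall>k. (LINT r|lborel. rep_L2 u r * partial_deriv k \<phi> r)
            = - (LINT r|lborel. rep_L2 (g $ k) r * \<phi> r)))"

definition H1 :: "L2 set" where
  "H1 = {u. \<exists>g. has_weak_gradient u g}"

definition weak_gradient :: "L2 \<Rightarrow> L2^3" where
  "weak_gradient u = (THE g. has_weak_gradient u g)"


section \<open>Tuples of functions\<close>

text \<open>An \<open>N\<close>-tuple is an element of \<^typ>\<open>L2^'n\<close> with \<open>N = CARD('n)\<close>. The library's inner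
  product on this type is the sum of the componentwise ones, which is the trace of \<open>gram\<close>, so
  \<open>norm\<close> is the norm written with triple bars in the literature.\<close>

definition gram :: "L2^'n \<Rightarrow> L2^'n \<Rightarrow> real^'n^'n" where
  "gram \<Psi> \<Phi> = (\<chi> i j. inner (\<Psi> $ i) (\<Phi> $ j))"

definition tuple_mult :: "L2^'n \<Rightarrow> real^'n^'n \<Rightarrow> L2^'n" where
  "tuple_mult U P = (\<chi> i. \<Sum>j\<in>UNIV. (P $ j $ i) *\<^sub>R (U $ j))"

definition tuples :: "L2 set \<Rightarrow> (L2^'n) set" where
  "tuples V = {U. \<forall>i. U $ i \<in> V}"

definition stiefel :: "(L2^'n) set" where
  "stiefel = {U \<in> tuples H1. gram U U = mat 1}"


section \<open>The Kohn-Sham energy\<close>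

definition ks_density :: "L2^'n \<Rightarrow> real^3 \<Rightarrow> real" where
  "ks_density U = (\<lambda>r. 2 * (\<Sum>i\<in>UNIV. \<bar>rep_L2 (U $ i) r\<bar>\<^sup>2))"

definition hartree_potential :: "(real^3 \<Rightarrow> real) \<Rightarrow> real^3 \<Rightarrow> real" where
  "hartree_potential \<rho> = (\<lambda>r. LINT r'|lborel. \<rho> r' / norm (r - r'))"

definition hartree_energy :: "(real^3 \<Rightarrow> real) \<Rightarrow> real" where
  "hartree_energy \<rho> =
     1 / 2 * (LINT r|lborel. (LINT r'|lborel. \<rho> r * \<rho> r' / norm (r - r')))"

text \<open>The exchange-correlation energy per particle \<open>\<epsilon>xc\<close> and the potential \<open>vxc\<close> map densities to
  functions of the position. Local approximations are the case \<open>\<epsilon>xc \<rho> r = e (\<rho> r)\<close>; dependence on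
  derivatives of the density is allowed as well.\<close>

definition xc_energy ::
  "((real^3 \<Rightarrow> real) \<Rightarrow> real^3 \<Rightarrow> real) \<Rightarrow> (real^3 \<Rightarrow> real) \<Rightarrow> real" where
  "xc_energy \<epsilon>xc \<rho> = (LINT r|lborel. \<epsilon>xc \<rho> r * \<rho> r)"

text \<open>The potential is the functional derivative of \<^term>\<open>xc_energy \<epsilon>xc\<close> on a set \<open>D\<close> of densities:
  a Frechet derivative in the \<open>L\<^sup>1\<close> norm, represented by integration against \<open>vxc \<rho>\<close>. The densities
  of tuples over a finite-dimensional space span a finite-dimensional space, on which the choice of
  the norm does not matter.\<close>

definition has_xc_potential ::
  "(real^3 \<Rightarrow> real) set \<Rightarrow> ((real^3 \<Rightarrow> real) \<Rightarrow> real^3 \<Rightarrow> real) \<Rightarrow>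
   ((real^3 \<Rightarrow> real) \<Rightarrow> real^3 \<Rightarrow> real) \<Rightarrow> bool" where
  "has_xc_potential D \<epsilon>xc vxc \<longleftrightarrow>
     (\<forall>\<rho>\<in>D. vxc \<rho> \<in> borel_measurable lborel \<and>
        integrable lborel (\<lambda>r. \<epsilon>xc \<rho> r * \<rho> r) \<and>
        (\<forall>\<sigma>\<in>D. integrable lborel (\<lambda>r. vxc \<rho> r * \<sigma> r)) \<and>
        (\<forall>e>0. \<exists>d>0. \<forall>\<sigma>\<in>D. (LINT r|lborel. \<bar>\<sigma> r - \<rho> r\<bar>) < d \<longrightarrow>
           \<bar>xc_energy \<epsilon>xc \<sigma> - xc_energy \<epsilon>xc \<rho> - (LINT r|lborel. vxc \<rho> r * (\<sigma> r - \<rho> r))\<bar>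
             \<le> e * (LINT r|lborel. \<bar>\<sigma> r - \<rho> r\<bar>)))"

definition ks_energy ::
  "(real^3 \<Rightarrow> real) \<Rightarrow> ((real^3 \<Rightarrow> real) \<Rightarrow> real^3 \<Rightarrow> real) \<Rightarrow> L2^'n \<Rightarrow> real" where
  "ks_energy Vext \<epsilon>xc U =
     (\<Sum>i\<in>UNIV. LINT r|lborel. (\<Sum>k\<in>UNIV. (rep_L2 (weak_gradient (U $ i) $ k) r)\<^sup>2))
     + (LINT r|lborel. Vext r * ks_density U r)
     + hartree_energy (ks_density U)
     + xc_energy \<epsilon>xc (ks_density U)"

text \<open>On the right-hand side, the inner product of the two weak gradients is the one of
  \<^typ>\<open>L2^3\<close>.\<close>

definition ks_gradient ::
  "L2 set \<Rightarrow> (real^3 \<Rightarrow> real) \<Rightarrow> ((real^3 \<Rightarrow> real) \<Rightarrow> real^3 \<Rightarrow> real) \<Rightarrow> L2^'n \<Rightarrow> L2^'n" where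
  "ks_gradient V Vext vxc U =
     (THE G. G \<in> tuples V \<and>
        (\<forall>i. \<forall>v\<in>V. inner (G $ i) v =
           4 * (1 / 2 * inner (weak_gradient (U $ i)) (weak_gradient v)
              + (LINT r|lborel. Vext r * rep_L2 (U $ i) r * rep_L2 v r)
              + (LINT r|lborel. hartree_potential (ks_density U) r * rep_L2 (U $ i) r * rep_L2 v r)
              + (LINT r|lborel. vxc (ks_density U) r * rep_L2 (U $ i) r * rep_L2 v r))))"

definition grassmann_gradient ::
  "L2 set \<Rightarrow> (real^3 \<Rightarrow> real) \<Rightarrow> ((real^3 \<Rightarrow> real) \<Rightarrow> real^3 \<Rightarrow> real) \<Rightarrow> L2^'n \<Rightarrow> L2^'n" where
  "grassmann_gradient V Vext vxc U =
     tuple_mult (ks_gradient V Vext vxc U) (gram U U)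
     - tuple_mult U (gram U (ks_gradient V Vext vxc U))"

end

theory Submission
  imports Defs
begin

text \<open>
  Write \<open>G\<close> for the gradient at \<open>U\<close>, \<open>A = gram U U\<close> and \<open>B = gram U G\<close>. Both matrices are symmetric, and
  the Gram matrix of \<open>U\<close> with the Grassmann gradient is the commutator \<open>B A - A B\<close>, which is
  antisymmetric. So \<open>A\<close> is constant along the flow. For \<open>A = 1\<close> the commutator vanishes, so that the
  inner product of \<open>G\<close> with the Grassmann gradient is the squared norm of the latter, and the chain
  rule gives the decay of the energy.

  The analytic input is that the Hartree potential of a product of two functions in \<open>H\<^sup>1\<close> is bounded,
  which follows from the uniform bound on the integrals of \<open>u\<^sup>2 / norm (x - a)\<close>. This bound comes from
  testing \<open>u\<^sup>2\<close> against difference quotients of the bounded vector field \<open>(x - a) / norm (x - a)\<close>,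
  whose divergence is \<open>2 / norm (x - a)\<close>. In an orthogonal basis of the finite-dimensional space the
  energy then becomes a differentiable function of finitely many coordinates.
\<close>

subsection \<open>Test functions\<close>

text \<open>The antisymmetry of the commutator holds at every tuple over \<open>V\<close>, so the
  Gram matrix is conserved before anything is known about orthonormality. The obstacle lies in the
  energy. A function in \<open>H1\<close> is only an equivalence class with a weak gradient, and an
  integral that does not converge silently takes the value 0, so the chain rule has to wait for
  absolute convergence of every term. At the Coulomb singularity this comes from finite differences:
  a weak derivative becomes usable almost everywhere once it is integrated along a segment, and the
  singular divergence appears only in the limit. Fatou's lemma takes that limit and asks for
  nonnegative quotients, which is why the test fields increase along the axes. The bound is uniform
  in \<open>a\<close> because it must make the potential a bounded function. The smooth bumps are
  there because test functions must separate square-integrable functions; otherwise the definite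
  description \<open>weak_gradient\<close> would have no meaning. In coordinates the kinetic,
  external and Hartree terms are polynomials; the exchange-correlation term is reached through the
  \<open>L\<^sup>1\<close> distance of densities.\<close>

text \<open>These functions form a class that is closed under differentiation, hence they are smooth; for
  \<open>p = 1\<close> the rescaled ones converge to the indicator function of the positive half-line.\<close>

definition flat :: "real poly \<Rightarrow> real \<Rightarrow> real" where
  "flat p t = (if 0 < t then poly p (1 / t) * exp (- (1 / t)) else 0)"

lemma poly_div_exp_tendsto_0: "((\<lambda>x. poly p x * exp (- x)) \<longlongrightarrow> 0) at_top" for p :: "real poly"
proof -
  have "((\<lambda>x. \<Sum>i\<le>degree p. coeff p i * (x ^ i / exp x)) \<longlongrightarrow> (\<Sum>i\<le>degree p. coeff p i * 0)) at_top"
    by (intro tendsto_intros tendsto_power_div_exp_0)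
  then show ?thesis
    by (simp add: poly_altdef sum_divide_distrib exp_minus field_simps)
qed

text \<open>Put \<open>x = 1 / t\<close>. Then d/dt is \<open>- x\<^sup>2\<close> times d/dx, and
  differentiating \<open>poly p x * exp (- x)\<close> in \<open>x\<close> replaces \<open>p\<close>
  by \<open>pderiv p - p\<close>; the polynomial \<open>[:0, 0, 1:]\<close> is the factor
  \<open>x\<^sup>2\<close>.\<close>

lemma flat_deriv: "(flat p has_real_derivative flat ([:0, 0, 1:] * (p - pderiv p)) t) (at t)"
proof -
  consider "t < 0" | "t = 0" | "0 < t" by linarith
  then show ?thesis
  proof cases
    case 1
    have "((\<lambda>t. 0) has_real_derivative flat ([:0, 0, 1:] * (p - pderiv p)) t) (at t)"
      using 1 by (simp add: flat_def)
    then show ?thesis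
      by (rule has_field_derivative_transform_within_open[where S="{..<0}"]) (use 1 in \<open>auto simp: flat_def\<close>)
  next
    case 2
    have "((\<lambda>h. flat p h / h) \<longlongrightarrow> 0) (at_right 0)"
    proof -
      \<comment> \<open>With \<open>x = 1 / h\<close> the difference quotient at 0 is
        \<open>x * poly p x * exp (- x)\<close>, and \<open>pCons 0 p\<close> is \<open>x\<close>
        times \<open>p\<close>. From the left the quotient is identically 0.\<close>
      have "((\<lambda>h. poly (pCons 0 p) (inverse h) * exp (- inverse h)) \<longlongrightarrow> 0) (at_right (0::real))"
        by (rule filterlim_compose[OF poly_div_exp_tendsto_0 filterlim_inverse_at_top_right])
      then show ?thesis
        by (rule Lim_transform_eventually)
          (auto simp: eventually_at_right_field flat_def field_simps intro!: exI[of _ 1])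
    qed
    moreover have "((\<lambda>h. flat p h / h) \<longlongrightarrow> 0) (at_left 0)"
      by (rule Lim_transform_eventually[OF tendsto_const])
        (auto simp: eventually_at_left_field flat_def intro!: exI[of _ "-1"])
    ultimately have "((\<lambda>h. flat p h / h) \<longlongrightarrow> 0) (at 0)"
      by (simp add: filterlim_at_split)
    then show ?thesis
      using 2 by (simp add: DERIV_def flat_def)
  next
    case 3
    have "((\<lambda>t. poly p (1 / t) * exp (- (1 / t))) has_real_derivative flat ([:0, 0, 1:] * (p - pderiv p)) t) (at t)"
      using 3 by (auto intro!: derivative_eq_intros DERIV_chain2[OF poly_DERIV]
          simp: flat_def field_simps power2_eq_square)
    then show ?thesis
      by (rule has_field_derivative_transform_within_open[where S="{0<..}"]) (use 3 in \<open>auto simp: flat_def\<close>)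
  qed
qed

section \<open>Calculus of the classes \<open>Ck\<close>\<close>

lemma partial_deriv_eqI:
  assumes "(f has_derivative f') (at r)"
  shows "partial_deriv k f r = f' (axis k 1)"
  using frechet_derivative_at[OF assms] by (simp add: partial_deriv_def)

lemma differentiable_on_UNIV_frechet:
  "f differentiable_on UNIV \<Longrightarrow> (f has_derivative frechet_derivative f (at r)) (at r)"
  by (simp add: differentiable_on_def frechet_derivative_works)

lemma Ck_SucD: "Ck (Suc m) f \<Longrightarrow> Ck m f"
proof (induction m arbitrary: f)
  case 0
  then show ?case by (simp add: differentiable_imp_continuous_on)
next
  case (Suc m)
  then show ?case by (metis Ck.simps(2))
qed

lemma Ck_const: "Ck m (\<lambda>x. c)"
proof (induction m arbitrary: c)
  case (Suc m)
  have "partial_deriv k (\<lambda>x. c) = (\<lambda>x. 0)" for k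
    by (auto simp: partial_deriv_def)
  then show ?case using Suc by simp
qed simp

lemma Ck_add: "Ck m f \<Longrightarrow> Ck m g \<Longrightarrow> Ck m (\<lambda>x. f x + g x)"
proof (induction m arbitrary: f g)
  case 0
  then show ?case by (simp add: continuous_on_add)
next
  case (Suc m)
  then have d: "f differentiable_on UNIV" "g differentiable_on UNIV" by auto
  have "partial_deriv k (\<lambda>x. f x + g x) = (\<lambda>x. partial_deriv k f x + partial_deriv k g x)" for k
    by (rule ext, subst partial_deriv_eqI[OF has_derivative_add])
      (auto intro!: differentiable_on_UNIV_frechet d simp: partial_deriv_def)
  then show ?case using Suc d by auto
qed

lemma Ck_mult: "Ck m f \<Longrightarrow> Ck m g \<Longrightarrow> Ck m (\<lambda>x. f x * g x)"
proof (induction m arbitrary: f g)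
  case 0
  then show ?case by (simp add: continuous_on_mult)
next
  case (Suc m)
  then have d: "f differentiable_on UNIV" "g differentiable_on UNIV" by auto
  have "partial_deriv k (\<lambda>x. f x * g x) = (\<lambda>x. f x * partial_deriv k g x + partial_deriv k f x * g x)" for k
    by (rule ext, subst partial_deriv_eqI[OF has_derivative_mult])
      (auto intro!: differentiable_on_UNIV_frechet d simp: partial_deriv_def)
  moreover have "Ck m f" "Ck m g" using Suc.prems by (blast dest: Ck_SucD)+
  ultimately show ?case using Suc d by (auto intro!: Ck_add differentiable_on_mult)
qed

lemma Ck_prod: "finite A \<Longrightarrow> (\<And>i. i \<in> A \<Longrightarrow> Ck m (f i)) \<Longrightarrow> Ck m (\<lambda>x. \<Prod>i\<in>A. f i x)"
  by (induction rule: finite_induct) (auto intro: Ck_const Ck_mult)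

lemma Ck_flat: "Ck m (\<lambda>x. flat p (\<alpha> * x $ k + \<beta>))"
proof -
  have der: "((\<lambda>x. flat p (\<alpha> * x $ k + \<beta>)) has_derivative
      (\<lambda>h. (\<alpha> * h $ k) * flat ([:0, 0, 1:] * (p - pderiv p)) (\<alpha> * x $ k + \<beta>))) (at x)" for p x
    by (rule has_derivative_eq_rhs, rule DERIV_compose_FDERIV[OF flat_deriv])
      (auto intro!: derivative_eq_intros bounded_linear_imp_has_derivative)
  \<comment> \<open>The free factor \<open>c\<close> and the free polynomial \<open>p\<close> close
    the induction: a partial derivative only changes \<open>p\<close> and multiplies
    \<open>c\<close> by \<open>\<alpha>\<close> or by 0, according to the direction.\<close>
  have "Ck m (\<lambda>x. c * flat p (\<alpha> * x $ k + \<beta>))" for c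
  proof (induction m arbitrary: c p)
    case 0
    have "continuous_on UNIV (\<lambda>x. flat p (\<alpha> * x $ k + \<beta>))"
      by (intro continuous_at_imp_continuous_on ballI has_derivative_continuous[OF der])
    then show ?case by (simp add: continuous_on_mult_left)
  next
    case (Suc m)
    have d: "((\<lambda>x. c * flat p (\<alpha> * x $ k + \<beta>)) has_derivative
      (\<lambda>h. c * ((\<alpha> * h $ k) * flat ([:0, 0, 1:] * (p - pderiv p)) (\<alpha> * x $ k + \<beta>)))) (at x)" for x
      by (rule has_derivative_mult_right[OF der])
    have "partial_deriv j (\<lambda>x. c * flat p (\<alpha> * x $ k + \<beta>)) =
       (\<lambda>x. (c * (\<alpha> * axis j 1 $ k)) * flat ([:0, 0, 1:] * (p - pderiv p)) (\<alpha> * x $ k + \<beta>))" for j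
      by (rule ext, subst partial_deriv_eqI[OF d]) (simp add: mult.assoc)
    moreover have "(\<lambda>x. c * flat p (\<alpha> * x $ k + \<beta>)) differentiable_on UNIV"
      using d by (auto simp: differentiable_on_def differentiable_def)
    ultimately show ?case using Suc by (simp del: mult_pCons_left)
  qed
  from this[of 1] show ?thesis by simp
qed

text \<open>A smooth approximation of the indicator of \<open>box a b\<close> from below, which
  sharpens as \<open>n\<close> grows. The arguments are left expanded as affine functions of
  \<open>x $ k\<close> so that they match \<open>Ck_flat\<close>.\<close>

definition bump :: "real^3 \<Rightarrow> real^3 \<Rightarrow> nat \<Rightarrow> real^3 \<Rightarrow> real" where
  "bump a b n x = (\<Prod>k\<in>UNIV. flat 1 (real n * x $ k + - (real n * a $ k)) * flat 1 (- real n * x $ k + real n * b $ k))"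

lemma flat_1_bounds: "0 \<le> flat 1 t" "flat 1 t \<le> 1"
  by (auto simp: flat_def)

lemma bump_nonneg: "0 \<le> bump a b n x"
  unfolding bump_def by (intro prod_nonneg) (simp add: flat_1_bounds)

lemma bump_le: "bump a b n x \<le> indicator (box a b) x"
proof (cases "x \<in> box a b")
  case True
  have "bump a b n x \<le> (\<Prod>k\<in>(UNIV::3 set). 1)"
    unfolding bump_def by (intro prod_mono) (simp add: flat_1_bounds mult_le_one)
  then show ?thesis using True by simp
next
  case False
  then obtain k where "\<not> (a $ k < x $ k \<and> x $ k < b $ k)"
    by (auto simp: mem_box_cart)
  then have "real n * x $ k + - (real n * a $ k) \<le> 0 \<or> - real n * x $ k + real n * b $ k \<le> 0"
    by (auto simp: mult_left_mono not_less)
  then have "flat 1 (real n * x $ k + - (real n * a $ k)) * flat 1 (- real n * x $ k + real n * b $ k) = 0"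
    by (auto simp: flat_def)
  then have "bump a b n x = 0"
    unfolding bump_def by (intro prod_zero) (auto intro!: bexI[of _ k])
  then show ?thesis by simp
qed

lemma flat_1_tendsto_1:
  assumes "0 < t"
  shows "(\<lambda>n. flat 1 (real n * t)) \<longlonglongrightarrow> 1"
proof -
  have "(\<lambda>n. exp (- (inverse t * inverse (real n)))) \<longlonglongrightarrow> exp (- (inverse t * 0))"
    by (intro tendsto_intros lim_inverse_n)
  then have "(\<lambda>n. exp (- (inverse t * inverse (real n)))) \<longlonglongrightarrow> 1" by simp
  then show ?thesis
    by (rule Lim_transform_eventually)
      (use assms in \<open>auto simp: eventually_sequentially flat_def field_simps intro!: exI[of _ 1]\<close>)
qed

lemma bump_tendsto: "(\<lambda>n. bump a b n x) \<longlonglongrightarrow> indicator (box a b) x"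
proof (cases "x \<in> box a b")
  case True
  have "(\<lambda>n. bump a b n x) \<longlonglongrightarrow> (\<Prod>k\<in>(UNIV::3 set). 1 * 1)"
    unfolding bump_def
  proof (intro tendsto_prod tendsto_mult)
    fix k
    show "(\<lambda>n. flat 1 (real n * x $ k + - (real n * a $ k))) \<longlonglongrightarrow> 1"
      using flat_1_tendsto_1[of "x $ k - a $ k"] True by (simp add: mem_box_cart right_diff_distrib)
    show "(\<lambda>n. flat 1 (- real n * x $ k + real n * b $ k)) \<longlonglongrightarrow> 1"
      using flat_1_tendsto_1[of "b $ k - x $ k"] True by (simp add: mem_box_cart right_diff_distrib)
  qed
  then show ?thesis using True by simp
next
  case False
  then have "bump a b n x = 0" for n
    using bump_le[of a b n x] bump_nonneg[of a b n x] by simp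
  then show ?thesis using False by simp
qed

lemma compact_closure_subset:
  fixes S :: "'a::heine_borel set"
  shows "S \<subseteq> T \<Longrightarrow> compact T \<Longrightarrow> compact (closure S)"
  by (meson bounded_subset compact_closure compact_imp_bounded)

lemma test_function_bump: "test_function (bump a b n)"
proof -
  have "{x. bump a b n x \<noteq> 0} \<subseteq> cbox a b"
  proof
    fix x assume "x \<in> {x. bump a b n x \<noteq> 0}"
    then have "x \<in> box a b"
      using bump_le[of a b n x] bump_nonneg[of a b n x] by (cases "x \<in> box a b") auto
    then show "x \<in> cbox a b" using box_subset_cbox by blast
  qed
  then have "compact (closure {x. bump a b n x \<noteq> 0})"
    by (rule compact_closure_subset) simp
  moreover have "Ck m (bump a b n)" for m
    unfolding bump_def[abs_def] by (intro Ck_prod Ck_mult Ck_flat finite)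
  ultimately show ?thesis
    by (simp add: test_function_def)
qed

lemma test_functionD:
  assumes "test_function \<phi>"
  shows "\<phi> differentiable_on UNIV" "continuous_on UNIV \<phi>" "compact (closure {r. \<phi> r \<noteq> 0})"
    "test_function (partial_deriv k \<phi>)"
proof -
  have C: "Ck m \<phi>" for m
    using assms by (auto simp: test_function_def)
  have c: "compact (closure {r. \<phi> r \<noteq> 0})"
    using assms by (auto simp: test_function_def)
  show "compact (closure {r. \<phi> r \<noteq> 0})" by fact
  show "\<phi> differentiable_on UNIV" "continuous_on UNIV \<phi>"
    using C[of "Suc 0"] C[of 0] by auto
  \<comment> \<open>Outside the closed support \<open>\<phi>\<close> vanishes on a whole
    neighbourhood of \<open>r\<close>, so differentiation does not enlarge the support.\<close>
  have "partial_deriv k \<phi> r = 0" if "r \<notin> closure {r. \<phi> r \<noteq> 0}" for r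
  proof -
    have "((\<lambda>x. 0) has_derivative (\<lambda>h. 0)) (at r)" by simp
    then have "(\<phi> has_derivative (\<lambda>h. 0)) (at r)"
      by (rule has_derivative_transform_within_open[where s="- closure {r. \<phi> r \<noteq> 0}"])
        (use that closure_subset[of "{r. \<phi> r \<noteq> 0}"] in auto)
    then show ?thesis by (rule partial_deriv_eqI)
  qed
  then have "{r. partial_deriv k \<phi> r \<noteq> 0} \<subseteq> closure {r. \<phi> r \<noteq> 0}" by auto
  moreover have "Ck m (partial_deriv k \<phi>)" for m
    using C[of "Suc m"] by simp
  ultimately show "test_function (partial_deriv k \<phi>)"
    using compact_closure_subset[OF _ c] by (auto simp only: test_function_def)
qed

section \<open>Translates and square-integrability of test functions\<close>

lemma partial_deriv_shift:
  assumes "\<phi> differentiable_on UNIV"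
  shows "partial_deriv k (\<lambda>x. \<phi> (x + c)) = (\<lambda>x. partial_deriv k \<phi> (x + c))"
    and "(\<lambda>x. \<phi> (x + c)) differentiable_on UNIV"
proof -
  have d: "((\<lambda>x. \<phi> (x + c)) has_derivative frechet_derivative \<phi> (at (x + c))) (at x)" for x
    by (rule has_derivative_eq_rhs, rule has_derivative_compose[where g=\<phi>])
      (auto intro!: derivative_eq_intros differentiable_on_UNIV_frechet[OF assms])
  show "partial_deriv k (\<lambda>x. \<phi> (x + c)) = (\<lambda>x. partial_deriv k \<phi> (x + c))"
    by (rule ext, subst partial_deriv_eqI[OF d]) (simp add: partial_deriv_def)
  show "(\<lambda>x. \<phi> (x + c)) differentiable_on UNIV"
    using d by (auto simp: differentiable_on_def differentiable_def)
qed

lemma Ck_shift: "Ck m \<phi> \<Longrightarrow> Ck m (\<lambda>x. \<phi> (x + c))"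
proof (induction m arbitrary: \<phi>)
  case 0
  then show ?case by (auto intro!: continuous_on_compose2[of UNIV \<phi>] continuous_intros)
next
  case (Suc m)
  then show ?case by (auto simp: partial_deriv_shift)
qed

lemma test_function_shift:
  assumes "test_function \<phi>"
  shows "test_function (\<lambda>x. \<phi> (x + c))"
proof -
  have "{r. \<phi> (r + c) \<noteq> 0} \<subseteq> (\<lambda>x. - c + x) ` closure {r. \<phi> r \<noteq> 0}"
  proof
    fix r assume "r \<in> {r. \<phi> (r + c) \<noteq> 0}"
    then have "r + c \<in> closure {r. \<phi> r \<noteq> 0}" using closure_subset[of "{r. \<phi> r \<noteq> 0}"] by auto
    then show "r \<in> (\<lambda>x. - c + x) ` closure {r. \<phi> r \<noteq> 0}" by force
  qed
  moreover have "compact ((\<lambda>x. - c + x) ` closure {r. \<phi> r \<noteq> 0})"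
    by (rule compact_translation) (use assms in \<open>simp add: test_function_def\<close>)
  ultimately have "compact (closure {r. \<phi> (r + c) \<noteq> 0})"
    by (rule compact_closure_subset)
  then show ?thesis
    using assms by (simp add: test_function_def Ck_shift)
qed

lemma test_function_bounded:
  assumes "test_function \<phi>"
  obtains B where "\<And>x. \<bar>\<phi> x\<bar> \<le> B"
proof -
  have "compact (\<phi> ` closure {r. \<phi> r \<noteq> 0})"
    using test_functionD[OF assms] by (meson compact_continuous_image continuous_on_subset subset_UNIV)
  then obtain B where B: "\<And>x. x \<in> closure {r. \<phi> r \<noteq> 0} \<Longrightarrow> \<bar>\<phi> x\<bar> \<le> B"
    by (force dest!: compact_imp_bounded simp: bounded_iff)
  have "\<bar>\<phi> x\<bar> \<le> max B 0" for x
  proof (cases "\<phi> x = 0")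
    case False
    then have "x \<in> closure {r. \<phi> r \<noteq> 0}" using closure_subset[of "{r. \<phi> r \<noteq> 0}"] by auto
    then show ?thesis using B by force
  qed simp
  then show ?thesis by (rule that)
qed

abbreviation sq_integrable :: "(real^3 \<Rightarrow> real) \<Rightarrow> bool" where
  "sq_integrable f \<equiv> L2_rel f f"

lemma test_function_measurable: "test_function \<phi> \<Longrightarrow> \<phi> \<in> borel_measurable borel"
  by (simp add: test_functionD borel_measurable_continuous_onI)

lemma sq_integrable_test_function:
  assumes "test_function \<phi>"
  shows "sq_integrable \<phi>"
proof -
  obtain B where B: "\<And>x. \<bar>\<phi> x\<bar> \<le> B" using test_function_bounded[OF assms] by blast
  let ?K = "closure {r. \<phi> r \<noteq> 0}"
  have K: "compact ?K" using assms by (simp add: test_function_def)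
  have "integrable lborel (\<lambda>x. B\<^sup>2 * indicator ?K x)"
    using emeasure_compact_finite[OF K] K by (intro integrable_mult_right) (auto simp: borel_compact)
  moreover have "norm ((\<phi> x)\<^sup>2) \<le> norm (B\<^sup>2 * indicator ?K x)" for x
  proof (cases "\<phi> x = 0")
    case False
    then have "x \<in> ?K" using closure_subset[of "{r. \<phi> r \<noteq> 0}"] by auto
    then show ?thesis using B[of x] by (simp add: abs_le_square_iff[symmetric])
  qed simp
  ultimately have "integrable lborel (\<lambda>x. (\<phi> x)\<^sup>2)"
    using test_function_measurable[OF assms]
    by (intro Bochner_Integration.integrable_bound[where g="\<lambda>x. (\<phi> x)\<^sup>2" and f="\<lambda>x. B\<^sup>2 * indicator ?K x"]) auto
  then show ?thesis
    using test_function_measurable[OF assms] by (simp add: L2_rel_refl_iff)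
qed

subsection \<open>Uniqueness and linearity of weak gradients\<close>

lemma nn_integral_lborel_translation:
  fixes f :: "'a::euclidean_space \<Rightarrow> ennreal"
  assumes [measurable]: "f \<in> borel_measurable borel"
  shows "(\<integral>\<^sup>+x. f (x + c) \<partial>lborel) = (\<integral>\<^sup>+x. f x \<partial>lborel)"
  by (subst (2) lborel_distr_plus[of c, symmetric]) (simp add: nn_integral_distr add.commute)

lemma integral_lborel_translation:
  fixes f :: "'a::euclidean_space \<Rightarrow> real"
  assumes [measurable]: "f \<in> borel_measurable borel"
  shows "(LINT x|lborel. f (x + c)) = (LINT x|lborel. f x)"
  by (subst (2) lborel_distr_plus[of c, symmetric]) (simp add: integral_distr add.commute)

lemma integrable_lborel_translation:
  fixes f :: "'a::euclidean_space \<Rightarrow> real"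
  assumes [measurable]: "f \<in> borel_measurable borel"
  shows "integrable lborel (\<lambda>x. f (x + c)) \<longleftrightarrow> integrable lborel f"
  by (subst (2) lborel_distr_plus[of c, symmetric]) (simp add: integrable_distr_eq add.commute)

lemma L2_relD:
  assumes "sq_integrable f"
  shows "f \<in> borel_measurable borel" "integrable lborel (\<lambda>x. (f x)\<^sup>2)"
  using assms by (simp_all add: L2_rel_refl_iff)

lemma sq_integrable_translation:
  assumes "sq_integrable f"
  shows "sq_integrable (\<lambda>x. f (x + c))"
proof -
  have [measurable]: "f \<in> borel_measurable borel" using L2_relD[OF assms] by simp
  show ?thesis
    using L2_relD[OF assms] integrable_lborel_translation[of "\<lambda>x. (f x)\<^sup>2" c]
    by (simp add: L2_rel_refl_iff)
qed

lemma sq_integrable_mult: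
  assumes "sq_integrable f" "sq_integrable g"
  shows "integrable lborel (\<lambda>x. f x * g x)"
  using assms by (auto simp: L2_rel_refl_iff intro: integrable_mult_square_integrable)

section \<open>Representatives of classes, determined almost everywhere\<close>

lemma sq_integrable_rep: "sq_integrable (rep_L2 u)"
  using Quotient3_rep_reflp[OF Quotient3_L2] .

lemma rep_L2_measurable [measurable]: "rep_L2 u \<in> borel_measurable borel"
  using L2_relD[OF sq_integrable_rep] by simp

lemma AE_rep_abs_L2:
  assumes "sq_integrable f"
  shows "AE r in lborel. rep_L2 (abs_L2 f) r = f r"
  using rep_abs_rsp_left[OF Quotient3_L2, of f f] assms by (simp add: L2_rel_def)

lemma L2_eqI: "(AE r in lborel. rep_L2 u r = rep_L2 v r) \<Longrightarrow> u = v"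
  using sq_integrable_rep[of u] sq_integrable_rep[of v]
  by (subst Quotient3_rel_rep[OF Quotient3_L2, symmetric]) (simp add: L2_rel_def)

lemma rep_L2_add: "AE r in lborel. rep_L2 (u + v) r = rep_L2 u r + rep_L2 v r"
proof -
  have "sq_integrable (\<lambda>r. rep_L2 u r + rep_L2 v r)"
    using sq_integrable_rep[of u] sq_integrable_rep[of v]
    by (simp add: L2_rel_refl_iff square_integrable_add)
  from AE_rep_abs_L2[OF this] show ?thesis by (simp add: plus_L2_def)
qed

lemma rep_L2_scaleR: "AE r in lborel. rep_L2 (c *\<^sub>R u) r = c * rep_L2 u r"
proof -
  have "sq_integrable (\<lambda>r. c * rep_L2 u r)"
    using sq_integrable_rep[of u] by (simp add: L2_rel_refl_iff power_mult_distrib)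
  from AE_rep_abs_L2[OF this] show ?thesis by (simp add: scaleR_L2_def)
qed

lemma rep_L2_linear: "AE r in lborel. rep_L2 (a *\<^sub>R u + b *\<^sub>R v) r = a * rep_L2 u r + b * rep_L2 v r"
  using rep_L2_add[of "a *\<^sub>R u" "b *\<^sub>R v"] rep_L2_scaleR[of a u] rep_L2_scaleR[of b v]
  by eventually_elim simp

lemma rep_L2_zero: "AE r in lborel. rep_L2 0 r = 0"
  using AE_rep_abs_L2[of "\<lambda>_. 0"] by (simp add: zero_L2_def L2_rel_refl_iff)

lemma rep_L2_sum: "AE r in lborel. rep_L2 (\<Sum>i\<in>A. f i) r = (\<Sum>i\<in>A. rep_L2 (f i) r)"
proof (induction A rule: infinite_finite_induct)
  case (insert x F)
  have "AE r in lborel. rep_L2 (f x + (\<Sum>i\<in>F. f i)) r = rep_L2 (f x) r + rep_L2 (\<Sum>i\<in>F. f i) r"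
    by (rule rep_L2_add)
  with insert.IH insert.hyps show ?case by auto
qed (use rep_L2_zero in auto)

lemma inner_L2_eq: "inner u v = (LINT r|lborel. rep_L2 u r * rep_L2 v r)"
  by (simp add: inner_L2_def)

text \<open>The positive and the negative part of \<open>w\<close> are densities of two measures
  that agree, with finite values, on boxes. Boxes are stable under intersection, generate the Borel
  sets and exhaust the space, so the measures agree, and then so do the densities almost everywhere.
  Since \<open>ennreal\<close> cuts negative numbers off at 0, both parts can be equal only where
  \<open>w\<close> vanishes.\<close>

lemma AE_eq_0_if_box_integrals_0:
  fixes w :: "real^3 \<Rightarrow> real"
  assumes [measurable]: "w \<in> borel_measurable borel"
    and loc: "\<And>a b. integrable lborel (\<lambda>x. w x * indicator (box a b) x)"
    and zero: "\<And>a b. (LINT x|lborel. w x * indicator (box a b) x) = 0"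
  shows "AE x in lborel. w x = 0"
proof -
  let ?M = "density lborel (\<lambda>x. ennreal (w x))" and ?N = "density lborel (\<lambda>x. ennreal (- w x))"
  have M: "emeasure ?M (box a b) = (\<integral>\<^sup>+x. ennreal (w x * indicator (box a b) x) \<partial>lborel)" for a b
    by (auto simp: emeasure_density intro!: nn_integral_cong split: split_indicator)
  have N: "emeasure ?N (box a b) = (\<integral>\<^sup>+x. ennreal (- (w x * indicator (box a b) x)) \<partial>lborel)" for a b
    by (auto simp: emeasure_density intro!: nn_integral_cong split: split_indicator)
  have fin: "(\<integral>\<^sup>+x. ennreal (w x * indicator (box a b) x) \<partial>lborel) < \<infinity>"
      "(\<integral>\<^sup>+x. ennreal (- (w x * indicator (box a b) x)) \<partial>lborel) < \<infinity>" for a b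
    using loc[of a b] by (auto simp: real_integrable_def top.not_eq_extremum)
  have eq: "emeasure ?M (box a b) = emeasure ?N (box a b)" for a b
  proof -
    have "enn2real (emeasure ?M (box a b)) = enn2real (emeasure ?N (box a b))"
      using zero[of a b] unfolding M N real_lebesgue_integral_def[OF loc] by linarith
    moreover have "emeasure ?M (box a b) < top" "emeasure ?N (box a b) < top"
      using fin[of a b] unfolding M N by simp_all
    ultimately show ?thesis
      by (metis ennreal_enn2real)
  qed
  have "?M = ?N"
  proof (rule measure_eqI_generator_eq)
    let ?E = "range (\<lambda>(a, b). box a b::(real^3) set)"
    show "Int_stable ?E"
      by (auto simp: Int_stable_def box_Int_box)
    show "?E \<subseteq> Pow UNIV" "sets ?M = sigma_sets UNIV ?E" "sets ?N = sigma_sets UNIV ?E"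
      by (simp_all add: borel_eq_box)
    let ?A = "\<lambda>n::nat. box (- (real n *\<^sub>R One)) (real n *\<^sub>R One) :: (real^3) set"
    show "range ?A \<subseteq> ?E" "(\<Union>i. ?A i) = UNIV"
      unfolding UN_box_eq_UNIV by auto
    show "emeasure ?M (?A i) \<noteq> \<infinity>" for i
      using fin(1) unfolding M by (simp add: less_top)
    show "emeasure ?M X = emeasure ?N X" if "X \<in> ?E" for X
      using that eq by auto
  qed
  then have "AE x in lborel. ennreal (w x) = ennreal (- w x)"
    by (subst (asm) sigma_finite_measure.density_unique_iff[OF sigma_finite_lborel]) auto
  then show ?thesis
  proof eventually_elim
    case (elim x)
    then have "enn2real (ennreal (w x)) = enn2real (ennreal (- w x))" by simp
    then show ?case by (cases "0 \<le> w x") (simp_all add: ennreal_neg)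
  qed
qed

text \<open>The fundamental lemma of the calculus of variations: the bumps converge to the indicator
  of a box and are dominated by it, so the box integrals of \<open>w\<close> are limits of
  zeros.\<close>

lemma AE_eq_0_if_orthogonal_test_functions:
  fixes w :: "real^3 \<Rightarrow> real"
  assumes [measurable]: "w \<in> borel_measurable borel"
    and loc: "\<And>a b. integrable lborel (\<lambda>x. w x * indicator (box a b) x)"
    and zero: "\<And>\<phi>. test_function \<phi> \<Longrightarrow> (LINT x|lborel. w x * \<phi> x) = 0"
  shows "AE x in lborel. w x = 0"
proof (rule AE_eq_0_if_box_integrals_0)
  fix a b :: "real^3"
  have [measurable]: "bump a b n \<in> borel_measurable borel" for n
    by (rule test_function_measurable[OF test_function_bump])
  have "(\<lambda>n. LINT x|lborel. w x * bump a b n x) \<longlonglongrightarrow> (LINT x|lborel. w x * indicator (box a b) x)"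
  proof (rule integral_dominated_convergence)
    show "integrable lborel (\<lambda>x. \<bar>w x * indicator (box a b) x\<bar>)"
      using loc by (rule integrable_abs)
    show "AE x in lborel. (\<lambda>n. w x * bump a b n x) \<longlonglongrightarrow> w x * indicator (box a b) x"
      by (auto intro!: tendsto_mult_left bump_tendsto)
    show "AE x in lborel. norm (w x * bump a b n x) \<le> \<bar>w x * indicator (box a b) x\<bar>" for n
      using bump_le[of a b n] bump_nonneg[of a b n] by (auto simp: abs_mult mult_left_mono)
  qed auto
  then show "(LINT x|lborel. w x * indicator (box a b) x) = 0"
    by (simp add: zero test_function_bump LIMSEQ_const_iff)
qed (use loc in auto)

lemma sq_integrable_indicator_box: "sq_integrable (indicator (box a b))"
proof -
  have "integrable lborel (indicator (box a b) :: real^3 \<Rightarrow> real)"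
    by (simp add: emeasure_lborel_box_eq)
  moreover have "(indicator (box a b) x)\<^sup>2 = (indicator (box a b) x :: real)" for x
    by (simp split: split_indicator)
  ultimately show ?thesis by (simp add: L2_rel_refl_iff)
qed

text \<open>This gives the definite description \<open>weak_gradient\<close> its meaning; uniqueness
  is in the sense of classes, since representatives are fixed only up to null sets.\<close>

lemma has_weak_gradient_unique:
  assumes "has_weak_gradient u g" "has_weak_gradient u g'"
  shows "g = g'"
proof -
  have "g $ k = g' $ k" for k
  proof (rule L2_eqI)
    have "AE x in lborel. rep_L2 (g $ k) x - rep_L2 (g' $ k) x = 0"
    proof (rule AE_eq_0_if_orthogonal_test_functions)
      fix \<phi> assume t: "test_function \<phi>"
      have "(LINT r|lborel. rep_L2 (g $ k) r * \<phi> r) = (LINT r|lborel. rep_L2 (g' $ k) r * \<phi> r)"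
        using assms t unfolding has_weak_gradient_def by fastforce
      moreover have "integrable lborel (\<lambda>x. rep_L2 (h $ k) x * \<phi> x)" for h :: "L2^3"
        by (intro sq_integrable_mult sq_integrable_rep sq_integrable_test_function t)
      ultimately show "(LINT x|lborel. (rep_L2 (g $ k) x - rep_L2 (g' $ k) x) * \<phi> x) = 0"
        by (simp add: left_diff_distrib)
    next
      fix a b
      show "integrable lborel (\<lambda>x. (rep_L2 (g $ k) x - rep_L2 (g' $ k) x) * indicator (box a b) x)"
        unfolding left_diff_distrib
        by (intro Bochner_Integration.integrable_diff sq_integrable_mult sq_integrable_rep sq_integrable_indicator_box)
    qed measurable
    then show "AE r in lborel. rep_L2 (g $ k) r = rep_L2 (g' $ k) r" by simp
  qed
  then show ?thesis by (simp add: vec_eq_iff)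
qed

lemma weak_gradient_eqI: "has_weak_gradient u g \<Longrightarrow> weak_gradient u = g"
  unfolding weak_gradient_def by (rule the_equality) (auto dest: has_weak_gradient_unique)

lemma has_weak_gradient_weak_gradient: "u \<in> H1 \<Longrightarrow> has_weak_gradient u (weak_gradient u)"
  unfolding H1_def using weak_gradient_eqI by fastforce

lemma has_weak_gradient_linear:
  assumes "has_weak_gradient u g" "has_weak_gradient v h"
  shows "has_weak_gradient (a *\<^sub>R u + b *\<^sub>R v) (a *\<^sub>R g + b *\<^sub>R h)"
  unfolding has_weak_gradient_def
proof (intro allI impI)
  fix \<phi> k assume t: "test_function \<phi>"
  have int: "(LINT r|lborel. rep_L2 (a *\<^sub>R u + b *\<^sub>R v) r * \<psi> r) =
      a * (LINT r|lborel. rep_L2 u r * \<psi> r) + b * (LINT r|lborel. rep_L2 v r * \<psi> r)"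
    if "test_function \<psi>" for u v \<psi>
  proof -
    have [measurable]: "\<psi> \<in> borel_measurable borel" by (rule test_function_measurable[OF that])
    have "(LINT r|lborel. rep_L2 (a *\<^sub>R u + b *\<^sub>R v) r * \<psi> r) =
      (LINT r|lborel. a * (rep_L2 u r * \<psi> r) + b * (rep_L2 v r * \<psi> r))"
      by (rule integral_cong_AE) (use rep_L2_linear[of a u b v] in \<open>measurable, eventually_elim, simp add: algebra_simps\<close>)
    also have "\<dots> = a * (LINT r|lborel. rep_L2 u r * \<psi> r) + b * (LINT r|lborel. rep_L2 v r * \<psi> r)"
    proof -
      have "integrable lborel (\<lambda>r. rep_L2 w r * \<psi> r)" for w
        by (intro sq_integrable_mult sq_integrable_rep sq_integrable_test_function that)
      then show ?thesis by simp
    qed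
    finally show ?thesis .
  qed
  show "(LINT r|lborel. rep_L2 (a *\<^sub>R u + b *\<^sub>R v) r * partial_deriv k \<phi> r) =
        - (LINT r|lborel. rep_L2 ((a *\<^sub>R g + b *\<^sub>R h) $ k) r * \<phi> r)"
    using assms t unfolding vector_add_component vector_scaleR_component
      int[OF t] int[OF test_functionD(4)[OF t]] has_weak_gradient_def by simp
qed

lemma weak_gradient_linear:
  assumes "u \<in> H1" "v \<in> H1"
  shows "weak_gradient (a *\<^sub>R u + b *\<^sub>R v) = a *\<^sub>R weak_gradient u + b *\<^sub>R weak_gradient v"
  by (intro weak_gradient_eqI has_weak_gradient_linear has_weak_gradient_weak_gradient assms)

subsection \<open>A Hardy inequality\<close>

lemma two_abs_mult_le: "2 * \<bar>x * y\<bar> \<le> x\<^sup>2 + y\<^sup>2" for x y :: real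
  using sum_squares_bound[of "\<bar>x\<bar>" "\<bar>y\<bar>"] by (simp add: abs_mult)

text \<open>The licence for all later exchanges of the integrals in \<open>x\<close> and
  \<open>s\<close>. Integrating in \<open>x\<close> first, the bound by the sum of two squares is
  independent of \<open>s\<close> by translation invariance, and only the length of the interval
  remains.\<close>

lemma integrable_mult_translation:
  assumes p: "sq_integrable p" and q: "sq_integrable q"
  shows "integrable (lborel \<Otimes>\<^sub>M lborel) (\<lambda>(x, s). p x * q (x + s *\<^sub>R e) * indicator {0..h::real} s)"
proof (rule integrableI_bounded)
  have [measurable]: "p \<in> borel_measurable borel" "q \<in> borel_measurable borel"
    using L2_relD p q by blast+
  show "(\<lambda>(x, s). p x * q (x + s *\<^sub>R e) * indicator {0..h} s) \<in> borel_measurable (lborel \<Otimes>\<^sub>M lborel)"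
    by measurable
  let ?C = "(\<integral>\<^sup>+x. ennreal ((p x)\<^sup>2) \<partial>lborel) + (\<integral>\<^sup>+x. ennreal ((q x)\<^sup>2) \<partial>lborel)"
  have fin: "?C < \<infinity>"
    using L2_relD(2)[OF p] L2_relD(2)[OF q] by (simp add: nn_integral_eq_integral)
  have bd: "ennreal (norm (p x * q (x + s *\<^sub>R e) * indicator {0..h} s))
      \<le> (ennreal ((p x)\<^sup>2) + ennreal ((q (x + s *\<^sub>R e))\<^sup>2)) * indicator {0..h} s" for x s
  proof -
    have "\<bar>p x * q (x + s *\<^sub>R e)\<bar> \<le> (p x)\<^sup>2 + (q (x + s *\<^sub>R e))\<^sup>2"
      using two_abs_mult_le[of "p x" "q (x + s *\<^sub>R e)"] abs_ge_zero[of "p x * q (x + s *\<^sub>R e)"] by linarith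
    then show ?thesis
      by (auto split: split_indicator simp flip: ennreal_plus simp: ennreal_leI)
  qed
  have "(\<integral>\<^sup>+z. ennreal (norm (case z of (x, s) \<Rightarrow> p x * q (x + s *\<^sub>R e) * indicator {0..h} s)) \<partial>(lborel \<Otimes>\<^sub>M lborel))
      = (\<integral>\<^sup>+s. (\<integral>\<^sup>+x. ennreal (norm (p x * q (x + s *\<^sub>R e) * indicator {0..h} s)) \<partial>lborel) \<partial>lborel)"
    by (subst lborel_pair.nn_integral_snd[symmetric]) (auto simp: case_prod_unfold)
  also have "\<dots> \<le> (\<integral>\<^sup>+s. ?C * indicator {0..h} s \<partial>lborel)"
  proof (rule nn_integral_mono)
    fix s :: real
    have "(\<integral>\<^sup>+x. ennreal (norm (p x * q (x + s *\<^sub>R e) * indicator {0..h} s)) \<partial>lborel)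
       \<le> (\<integral>\<^sup>+x. (ennreal ((p x)\<^sup>2) + ennreal ((q (x + s *\<^sub>R e))\<^sup>2)) * indicator {0..h} s \<partial>lborel)"
      by (rule nn_integral_mono) (rule bd)
    also have "\<dots> = ?C * indicator {0..h} s"
      by (simp add: nn_integral_multc nn_integral_add
          nn_integral_lborel_translation[of "\<lambda>x. ennreal ((q x)\<^sup>2)" "s *\<^sub>R e"])
    finally show "(\<integral>\<^sup>+x. ennreal (norm (p x * q (x + s *\<^sub>R e) * indicator {0..h} s)) \<partial>lborel) \<le> ?C * indicator {0..h} s" .
  qed
  also have "\<dots> = ?C * ennreal (max 0 h)"
    by (simp add: nn_integral_cmult max_def)
  also have "\<dots> < \<infinity>" using fin by (simp add: ennreal_mult_less_top)
  finally show "(\<integral>\<^sup>+z. ennreal (norm (case z of (x, s) \<Rightarrow> p x * q (x + s *\<^sub>R e) * indicator {0..h} s)) \<partial>(lborel \<Otimes>\<^sub>M lborel)) < \<infinity>" .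
qed

text \<open>The fundamental theorem of calculus along a segment. The direction is negative because
  the difference arrives here after a forward translation of the other factor has been moved onto
  \<open>\<phi>\<close>.\<close>

lemma test_function_difference:
  assumes t: "test_function \<phi>" and h: "0 \<le> h"
  shows "\<phi> (x + - h *\<^sub>R axis k 1) - \<phi> x =
    - (LINT s|lborel. partial_deriv k \<phi> (x + s *\<^sub>R (- axis k 1)) * indicator {0..h} s)"
proof -
  let ?e = "axis k 1 :: real^3"
  have cont: "continuous_on UNIV (partial_deriv k \<phi>)"
    using test_functionD[OF test_functionD(4)[OF t]] by blast
  have "((\<lambda>s. \<phi> (x + s *\<^sub>R (- ?e))) has_vector_derivative - partial_deriv k \<phi> (x + s *\<^sub>R (- ?e))) (at s within {0..h})" for s
  proof -
    have F: "(\<phi> has_derivative frechet_derivative \<phi> (at (x + s *\<^sub>R (- ?e)))) (at (x + s *\<^sub>R (- ?e)))"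
      by (rule differentiable_on_UNIV_frechet[OF test_functionD(1)[OF t]])
    have "((\<lambda>s. \<phi> (x + s *\<^sub>R (- ?e))) has_derivative
        (\<lambda>h. frechet_derivative \<phi> (at (x + s *\<^sub>R (- ?e))) (h *\<^sub>R (- ?e)))) (at s)"
      by (rule has_derivative_compose[where f="\<lambda>s. x + s *\<^sub>R (- ?e)" and g=\<phi>, OF _ F])
        (auto intro!: derivative_eq_intros)
    moreover have "frechet_derivative \<phi> (at (x + s *\<^sub>R (- ?e))) (h *\<^sub>R (- ?e)) =
       h *\<^sub>R (- partial_deriv k \<phi> (x + s *\<^sub>R (- ?e)))" for h
      using has_derivative_bounded_linear[OF F]
      by (simp add: partial_deriv_def linear_simps)
    ultimately show ?thesis
      by (simp add: has_vector_derivative_def has_derivative_at_withinI)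
  qed
  then have "has_bochner_integral lborel (\<lambda>s. indicator {0..h} s *\<^sub>R - partial_deriv k \<phi> (x + s *\<^sub>R (- ?e)))
      (\<phi> (x + h *\<^sub>R (- ?e)) - \<phi> (x + 0 *\<^sub>R (- ?e)))"
    using h by (intro has_bochner_integral_FTC_Icc)
       (auto intro!: continuous_intros continuous_on_compose2[OF cont])
  then show ?thesis
    by (auto simp: has_bochner_integral_iff mult.commute)
qed

text \<open>The fundamental theorem of calculus for weak derivatives, proved by duality: paired with
  a test function, the shift moves onto the smooth factor, where the classical theorem applies. For
  each \<open>s\<close> the translate of \<open>\<phi>\<close> is again a test function, so the weak
  gradient can be brought in under the integral over \<open>s\<close>, and the shift moves
  back.\<close>

lemma H1_difference_eq_integral:
  assumes wg: "has_weak_gradient u g" and h: "0 \<le> h"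
  shows "AE x in lborel. rep_L2 u (x + h *\<^sub>R axis k 1) - rep_L2 u x =
    (LINT s|lborel. rep_L2 (g $ k) (x + s *\<^sub>R axis k 1) * indicator {0..h} s)"
proof -
  let ?e = "axis k 1 :: real^3"
  let ?f = "rep_L2 u" and ?g = "rep_L2 (g $ k)"
  let ?G = "\<lambda>x. LINT s|lborel. ?g (x + s *\<^sub>R ?e) * indicator {0..h} s"
  have Gm [measurable]: "?G \<in> borel_measurable borel" by measurable
  have Gint: "integrable lborel (\<lambda>x. ?G x * p x)" if "sq_integrable p" for p
    using lborel_pair.integrable_fst'[OF integrable_mult_translation[OF that sq_integrable_rep[of "g $ k"], of ?e h]]
    by (simp add: mult.assoc mult.commute[of _ "p _"])
  have fint: "integrable lborel (\<lambda>x. ?f (x + c) * p x)" if "sq_integrable p" for c p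
    by (intro sq_integrable_mult sq_integrable_translation sq_integrable_rep that)
  have "AE x in lborel. ?f (x + h *\<^sub>R ?e) - ?f x - ?G x = 0"
  proof (rule AE_eq_0_if_orthogonal_test_functions)
    fix a b
    show "integrable lborel (\<lambda>x. (?f (x + h *\<^sub>R ?e) - ?f x - ?G x) * indicator (box a b) x)"
      unfolding left_diff_distrib using fint[OF sq_integrable_indicator_box, of 0 a b]
      by (intro Bochner_Integration.integrable_diff fint Gint sq_integrable_indicator_box) simp
  next
    fix \<phi> assume t: "test_function \<phi>"
    note sq = sq_integrable_test_function[OF t] sq_integrable_test_function[OF test_functionD(4)[OF t, of k]]
    have [measurable]: "\<phi> \<in> borel_measurable borel" by (rule test_function_measurable[OF t])
    have shift: "(LINT x|lborel. p (x + c) * q x) = (LINT x|lborel. p x * q (x - c))"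
      if [measurable]: "p \<in> borel_measurable borel" "q \<in> borel_measurable borel" for p q :: "real^3 \<Rightarrow> real" and c
      using integral_lborel_translation[of "\<lambda>x. p x * q (x - c)" c] by simp
    have "(LINT x|lborel. ?f (x + h *\<^sub>R ?e) * \<phi> x) - (LINT x|lborel. ?f x * \<phi> x)
        = (LINT x|lborel. ?f x * \<phi> (x + - h *\<^sub>R ?e)) - (LINT x|lborel. ?f x * \<phi> x)"
      by (simp add: shift)
    also have "\<dots> = (LINT x|lborel. ?f x * (\<phi> (x + - h *\<^sub>R ?e) - \<phi> x))"
      unfolding right_diff_distrib
      by (subst Bochner_Integration.integral_diff)
        (auto intro!: sq_integrable_mult sq_integrable_rep sq sq_integrable_translation[OF sq(1), of "- (h *\<^sub>R ?e)", simplified])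
    also have "\<dots> = - (LINT x|lborel. (LINT s|lborel. ?f x * partial_deriv k \<phi> (x + s *\<^sub>R - ?e) * indicator {0..h} s))"
      by (simp only: test_function_difference[OF t h] mult.assoc integral_mult_right_zero) simp
    also have "\<dots> = - (LINT s|lborel. (LINT x|lborel. ?f x * partial_deriv k \<phi> (x + s *\<^sub>R - ?e) * indicator {0..h} s))"
      by (subst lborel_pair.Fubini_integral) (auto intro!: integrable_mult_translation sq sq_integrable_rep simp del: scaleR_minus_right)
    also have "\<dots> = (LINT s|lborel. (LINT x|lborel. \<phi> x * ?g (x + s *\<^sub>R ?e) * indicator {0..h} s))"
    proof -
      have "(LINT x|lborel. ?f x * partial_deriv k \<phi> (x + s *\<^sub>R - ?e))
          = - (LINT x|lborel. \<phi> x * ?g (x + s *\<^sub>R ?e))" for s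
      proof -
        have "(LINT x|lborel. ?f x * partial_deriv k (\<lambda>x. \<phi> (x + s *\<^sub>R - ?e)) x)
            = - (LINT x|lborel. ?g x * \<phi> (x + s *\<^sub>R - ?e))"
          using wg test_function_shift[OF t, of "s *\<^sub>R - ?e"] unfolding has_weak_gradient_def by blast
        then show ?thesis
          by (simp add: partial_deriv_shift(1)[OF test_functionD(1)[OF t], of k "- s *\<^sub>R ?e", simplified]
              shift[of ?g \<phi> "s *\<^sub>R ?e", symmetric] mult.commute)
      qed
      then show ?thesis
        by (simp only: integral_mult_left_zero) simp
    qed
    also have "\<dots> = (LINT x|lborel. (LINT s|lborel. \<phi> x * ?g (x + s *\<^sub>R ?e) * indicator {0..h} s))"
      by (subst lborel_pair.Fubini_integral) (auto intro!: integrable_mult_translation sq sq_integrable_rep)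
    also have "\<dots> = (LINT x|lborel. ?G x * \<phi> x)"
      by (simp only: mult.assoc integral_mult_right_zero) (simp only: mult.commute)
    finally show "(LINT x|lborel. (?f (x + h *\<^sub>R ?e) - ?f x - ?G x) * \<phi> x) = 0"
      using fint[OF sq(1)] fint[OF sq(1), of 0] Gint[OF sq(1)]
      by (simp add: left_diff_distrib)
  qed measurable
  then show ?thesis by simp
qed

text \<open>The point is the factor \<open>h\<close>, the length of the segment: it cancels when
  differences are divided by \<open>h\<close>, leaving a bound independent of \<open>h\<close>. It
  comes from exchanging the integrals and from
  \<open>2 * \<bar>x * y\<bar> \<le> x\<^sup>2 + y\<^sup>2\<close> with a translated second
  factor.\<close>

lemma integral_abs_mult_translation_le:
  assumes p: "sq_integrable p" and q: "sq_integrable q" and h: "0 \<le> h"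
  shows "(LINT x|lborel. \<bar>p x * (LINT s|lborel. q (x + s *\<^sub>R e) * indicator {0..h} s)\<bar>)
      \<le> h * ((LINT x|lborel. (p x)\<^sup>2) + (LINT x|lborel. (q x)\<^sup>2)) / 2" (is "?L \<le> _")
    and "integrable lborel (\<lambda>x. p x * (LINT s|lborel. q (x + s *\<^sub>R e) * indicator {0..h} s))"
proof -
  let ?P = "\<lambda>x s. p x * q (x + s *\<^sub>R e) * indicator {0..h} s"
  have P: "integrable (lborel \<Otimes>\<^sub>M lborel) (\<lambda>(x, s). ?P x s)"
    by (rule integrable_mult_translation[OF p q])
  have eq: "p x * (LINT s|lborel. q (x + s *\<^sub>R e) * indicator {0..h} s) = (LINT s|lborel. ?P x s)" for x
    by (simp only: mult.assoc integral_mult_right_zero)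
  have aP: "integrable (lborel \<Otimes>\<^sub>M lborel) (\<lambda>(x, s). \<bar>?P x s\<bar>)"
    using integrable_abs[OF P] by (simp add: case_prod_unfold)
  show "integrable lborel (\<lambda>x. p x * (LINT s|lborel. q (x + s *\<^sub>R e) * indicator {0..h} s))"
    unfolding eq using lborel_pair.integrable_fst'[OF P] by simp
  then have I: "integrable lborel (\<lambda>x. \<bar>LINT s|lborel. ?P x s\<bar>)"
    unfolding eq by (rule integrable_abs)
  have "?L = (LINT x|lborel. \<bar>LINT s|lborel. ?P x s\<bar>)"
    by (simp only: eq)
  also have "\<dots> \<le> (LINT x|lborel. (LINT s|lborel. \<bar>?P x s\<bar>))"
    using I lborel_pair.integrable_fst'[OF aP] by (intro integral_mono integral_abs_bound) auto
  also have "\<dots> = (LINT s|lborel. (LINT x|lborel. \<bar>?P x s\<bar>))"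
    by (rule lborel_pair.Fubini_integral[OF aP, symmetric])
  also have "\<dots> \<le> (LINT s|lborel. ((LINT x|lborel. (p x)\<^sup>2) + (LINT x|lborel. (q x)\<^sup>2)) / 2 * indicator {0..h} s)"
  proof (rule integral_mono)
    show "integrable lborel (\<lambda>s. LINT x|lborel. \<bar>?P x s\<bar>)"
      using lborel_pair.integrable_snd[of "\<lambda>x s. \<bar>?P x s\<bar>", OF aP] .
    show "integrable lborel (\<lambda>s. ((LINT x|lborel. (p x)\<^sup>2) + (LINT x|lborel. (q x)\<^sup>2)) / 2 * indicator {0..h} s)"
      by (intro integrable_mult_right integrable_real_indicator) (auto simp: emeasure_lborel_Icc_eq)
  next
    fix s :: real
    have [measurable]: "p \<in> borel_measurable borel" "q \<in> borel_measurable borel"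
      using L2_relD p q by blast+
    note qs = sq_integrable_translation[OF q, of "s *\<^sub>R e"]
    have "(LINT x|lborel. \<bar>p x * q (x + s *\<^sub>R e)\<bar>) \<le> (LINT x|lborel. ((p x)\<^sup>2 + (q (x + s *\<^sub>R e))\<^sup>2) / 2)"
    proof (rule integral_mono)
      show "integrable lborel (\<lambda>x. \<bar>p x * q (x + s *\<^sub>R e)\<bar>)"
        by (intro integrable_abs sq_integrable_mult p qs)
      show "integrable lborel (\<lambda>x. ((p x)\<^sup>2 + (q (x + s *\<^sub>R e))\<^sup>2) / 2)"
        using L2_relD(2)[OF p] L2_relD(2)[OF qs] by simp
      show "\<bar>p x * q (x + s *\<^sub>R e)\<bar> \<le> ((p x)\<^sup>2 + (q (x + s *\<^sub>R e))\<^sup>2) / 2" for x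
        using two_abs_mult_le[of "p x" "q (x + s *\<^sub>R e)"] by simp
    qed
    also have "\<dots> = ((LINT x|lborel. (p x)\<^sup>2) + (LINT x|lborel. (q x)\<^sup>2)) / 2"
      using L2_relD(2)[OF p] L2_relD(2)[OF qs] integral_lborel_translation[of "\<lambda>x. (q x)\<^sup>2" "s *\<^sub>R e"]
      by simp
    finally show "(LINT x|lborel. \<bar>?P x s\<bar>)
       \<le> ((LINT x|lborel. (p x)\<^sup>2) + (LINT x|lborel. (q x)\<^sup>2)) / 2 * indicator {0..h} s"
      by (auto split: split_indicator)
  qed
  also have "\<dots> = h * ((LINT x|lborel. (p x)\<^sup>2) + (LINT x|lborel. (q x)\<^sup>2)) / 2"
    using h by simp
  finally show "?L \<le> h * ((LINT x|lborel. (p x)\<^sup>2) + (LINT x|lborel. (q x)\<^sup>2)) / 2" .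
qed

text \<open>Summation by parts moves the difference from \<open>F\<close> to \<open>u\<^sup>2\<close>, so that a bound on \<open>F\<close> itself
  suffices.\<close>

lemma H1_integral_difference_le:
  assumes wg: "has_weak_gradient u g"
    and [measurable]: "F \<in> borel_measurable borel" and F: "\<And>x. \<bar>F x\<bar> \<le> 1"
  shows "integrable lborel (\<lambda>x. (rep_L2 u x)\<^sup>2 * F (x + c))"
    and "0 \<le> h \<Longrightarrow> (LINT x|lborel. (rep_L2 u x)\<^sup>2 * (F x - F (x - h *\<^sub>R axis k 1)))
      \<le> h * ((4 * (norm u)\<^sup>2 + (norm (g $ k))\<^sup>2) / 2)"
proof -
  let ?f = "rep_L2 u" and ?g = "rep_L2 (g $ k)" and ?e = "axis k 1 :: real^3"
  define M where "M = (4 * (norm u)\<^sup>2 + (norm (g $ k))\<^sup>2) / 2"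
  have norm2: "(norm w)\<^sup>2 = (LINT x|lborel. (rep_L2 w x)\<^sup>2)" for w :: L2
    unfolding power2_norm_eq_inner inner_L2_eq by (simp only: power2_eq_square)
  have f2: "integrable lborel (\<lambda>x. (?f (x + c))\<^sup>2)" for c
    using L2_relD(2)[OF sq_integrable_translation[OF sq_integrable_rep]] .
  have I: "integrable lborel (\<lambda>x. (?f (x + c))\<^sup>2 * F (x + d))" for c d
    by (rule Bochner_Integration.integrable_bound[OF f2[of c]])
      (use F in \<open>auto simp: abs_mult intro!: AE_I2 mult_left_le\<close>)
  show "integrable lborel (\<lambda>x. (?f x)\<^sup>2 * F (x + c))"
    using I[of 0 c] by simp
  show "(LINT x|lborel. (?f x)\<^sup>2 * (F x - F (x - h *\<^sub>R axis k 1))) \<le> h * ((4 * (norm u)\<^sup>2 + (norm (g $ k))\<^sup>2) / 2)"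
    if h: "0 \<le> h"
  proof -
    let ?b = "\<lambda>x. ?f (x + h *\<^sub>R ?e) + ?f x"
    let ?G = "\<lambda>x. LINT s|lborel. ?g (x + s *\<^sub>R ?e) * indicator {0..h} s"
    have b: "sq_integrable ?b"
      using sq_integrable_translation[OF sq_integrable_rep[of u], of "h *\<^sub>R ?e"] sq_integrable_rep[of u]
      by (simp add: L2_rel_refl_iff square_integrable_add)
    have "(LINT x|lborel. (?f x)\<^sup>2 * (F x - F (x - h *\<^sub>R ?e)))
        = (LINT x|lborel. (?f x)\<^sup>2 * F x) - (LINT x|lborel. (?f x)\<^sup>2 * F (x - h *\<^sub>R ?e))"
      unfolding right_diff_distrib using I[of 0 0] I[of 0 "- (h *\<^sub>R ?e)"] by simp
    also have "(LINT x|lborel. (?f x)\<^sup>2 * F (x - h *\<^sub>R ?e)) = (LINT x|lborel. (?f (x + h *\<^sub>R ?e))\<^sup>2 * F x)"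
      using integral_lborel_translation[of "\<lambda>x. (?f x)\<^sup>2 * F (x - h *\<^sub>R ?e)" "h *\<^sub>R ?e"] by simp
    also have "(LINT x|lborel. (?f x)\<^sup>2 * F x) - \<dots> = (LINT x|lborel. (?f x)\<^sup>2 * F x - (?f (x + h *\<^sub>R ?e))\<^sup>2 * F x)"
      using I[of 0 0] I[of "h *\<^sub>R ?e" 0] by simp
    also have "\<dots> \<le> (LINT x|lborel. \<bar>?b x * ?G x\<bar>)"
    proof (rule integral_mono_AE)
      show "integrable lborel (\<lambda>x. (?f x)\<^sup>2 * F x - (?f (x + h *\<^sub>R ?e))\<^sup>2 * F x)"
        using I[of 0 0] I[of "h *\<^sub>R ?e" 0] by simp
      show "integrable lborel (\<lambda>x. \<bar>?b x * ?G x\<bar>)"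
        by (intro integrable_abs integral_abs_mult_translation_le(2) b sq_integrable_rep h)
      show "AE x in lborel. (?f x)\<^sup>2 * F x - (?f (x + h *\<^sub>R ?e))\<^sup>2 * F x \<le> \<bar>?b x * ?G x\<bar>"
        using H1_difference_eq_integral[OF wg h, of k]
      proof eventually_elim
        case (elim x)
        \<comment> \<open>A difference of squares is sum times difference; the difference is
          \<open>?G x\<close>, the integrated weak derivative.\<close>
        have "(?f x)\<^sup>2 * F x - (?f (x + h *\<^sub>R ?e))\<^sup>2 * F x = - (F x * (?b x * ?G x))"
          unfolding elim[symmetric] by (simp add: power2_eq_square algebra_simps)
        also have "\<dots> \<le> \<bar>F x\<bar> * \<bar>?b x * ?G x\<bar>"
          unfolding abs_mult[symmetric] by simp
        also have "\<dots> \<le> \<bar>?b x * ?G x\<bar>"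
          using F[of x] by (simp add: mult_left_le_one_le)
        finally show ?case .
      qed
    qed
    also have "\<dots> \<le> h * ((LINT x|lborel. (?b x)\<^sup>2) + (LINT x|lborel. (?g x)\<^sup>2)) / 2"
      by (rule integral_abs_mult_translation_le(1)[OF b sq_integrable_rep h])
    also have "\<dots> \<le> h * M"
    proof -
      \<comment> \<open>Origin of the constant 4: the square of a sum is at most twice the sum of
        the squares, and both squares have integral \<open>(norm u)\<^sup>2\<close>.\<close>
      have "(LINT x|lborel. (?b x)\<^sup>2) \<le> (LINT x|lborel. 2 * (?f (x + h *\<^sub>R ?e))\<^sup>2 + 2 * (?f x)\<^sup>2)"
      proof (rule integral_mono)
        show "integrable lborel (\<lambda>x. (?b x)\<^sup>2)" using L2_relD(2)[OF b] .
        show "integrable lborel (\<lambda>x. 2 * (?f (x + h *\<^sub>R ?e))\<^sup>2 + 2 * (?f x)\<^sup>2)"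
          using f2[of 0] f2[of "h *\<^sub>R ?e"] by simp
        show "(?b x)\<^sup>2 \<le> 2 * (?f (x + h *\<^sub>R ?e))\<^sup>2 + 2 * (?f x)\<^sup>2" for x
          using sum_squares_bound[of "?f (x + h *\<^sub>R ?e)" "?f x"] by (simp add: power2_sum)
      qed
      also have "\<dots> = 4 * (LINT x|lborel. (?f x)\<^sup>2)"
        using f2[of 0] f2[of "h *\<^sub>R ?e"] integral_lborel_translation[of "\<lambda>x. (?f x)\<^sup>2" "h *\<^sub>R ?e"] by simp
      finally show ?thesis
        unfolding M_def norm2 using h by (simp add: mult_left_mono)
    qed
    finally show "(LINT x|lborel. (?f x)\<^sup>2 * (F x - F (x - h *\<^sub>R ?e))) \<le> h * ((4 * (norm u)\<^sup>2 + (norm (g $ k))\<^sup>2) / 2)"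
      unfolding M_def .
  qed
qed

text \<open>This is a component of the unit radial field along a line parallel to its axis, with
  \<open>\<beta>\<close> collecting the squares of the other coordinates. For positive arguments the
  claim after squaring is \<open>s\<^sup>2 * \<beta> \<le> t\<^sup>2 * \<beta>\<close>; negative
  ones follow by oddness, and mixed signs are separated by 0.\<close>

lemma mono_div_sqrt:
  assumes "s \<le> t" "0 \<le> \<beta>"
  shows "s / sqrt (s\<^sup>2 + \<beta>) \<le> t / sqrt (t\<^sup>2 + \<beta>)"
proof -
  have pos: "s / sqrt (s\<^sup>2 + \<beta>) \<le> t / sqrt (t\<^sup>2 + \<beta>)" if "0 < s" "s \<le> t" for s t :: real
  proof -
    have p: "0 < s\<^sup>2 + \<beta>" "0 < t\<^sup>2 + \<beta>" using that \<open>0 \<le> \<beta>\<close> by (auto intro: add_pos_nonneg)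
    have "s * sqrt (t\<^sup>2 + \<beta>) = sqrt (s\<^sup>2 * (t\<^sup>2 + \<beta>))"
      using that by (simp add: real_sqrt_mult)
    also have "\<dots> \<le> sqrt (t\<^sup>2 * (s\<^sup>2 + \<beta>))"
      using that \<open>0 \<le> \<beta>\<close> by (simp add: algebra_simps mult_left_mono power_mono)
    also have "\<dots> = t * sqrt (s\<^sup>2 + \<beta>)"
      using that by (simp add: real_sqrt_mult)
    finally show ?thesis using p by (simp add: divide_le_eq field_simps)
  qed
  consider "0 < s" | "t < 0" | "s \<le> 0" "0 \<le> t" by linarith
  then show ?thesis
  proof cases
    case 1
    then show ?thesis using pos assms by blast
  next
    case 2
    then show ?thesis using pos[of "- t" "- s"] assms by simp
  next
    case 3
    then have "s / sqrt (s\<^sup>2 + \<beta>) \<le> 0" "0 \<le> t / sqrt (t\<^sup>2 + \<beta>)"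
      using assms(2) by (auto simp: divide_nonpos_nonneg)
    then show ?thesis by linarith
  qed
qed

lemma norm_eq_sqrt_coordinate:
  fixes y :: "real^'n"
  shows "norm (y + s *\<^sub>R axis k 1) = sqrt ((y $ k + s)\<^sup>2 + (\<Sum>j\<in>UNIV - {k}. (y $ j)\<^sup>2))"
proof -
  have "(\<Sum>j\<in>UNIV. ((y + s *\<^sub>R axis k 1) $ j)\<^sup>2) = (y $ k + s)\<^sup>2 + (\<Sum>j\<in>UNIV - {k}. ((y + s *\<^sub>R axis k 1) $ j)\<^sup>2)"
    by (subst sum.remove[of _ k]) auto
  also have "(\<Sum>j\<in>UNIV - {k}. ((y + s *\<^sub>R axis k 1) $ j)\<^sup>2) = (\<Sum>j\<in>UNIV - {k}. (y $ j)\<^sup>2)"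
    by (rule sum.cong) (auto simp: axis_def)
  finally show ?thesis by (simp add: norm_vec_def L2_set_def)
qed

text \<open>The fields \<open>(x $ k - a $ k) / norm (x - a)\<close> are bounded by \<open>1\<close> and increasing in direction \<open>k\<close>;
  their divergence is \<open>2 / norm (x - a)\<close>.\<close>

lemma H1_nn_integral_over_distance_le:
  assumes wg: "has_weak_gradient u g"
  shows "(\<integral>\<^sup>+x. ennreal ((rep_L2 u x)\<^sup>2 / norm (x - a)) \<partial>lborel)
      \<le> ennreal (\<Sum>k\<in>UNIV. (4 * (norm u)\<^sup>2 + (norm (g $ k))\<^sup>2) / 2)"
proof -
  let ?f = "rep_L2 u"
  define F where "F k x = (x $ k - a $ k) / norm (x - a)" for k and x :: "real^3"
  define D where "D k x = 1 / norm (x - a) - (x $ k - a $ k)\<^sup>2 / norm (x - a) ^ 3" for k and x :: "real^3"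
  define M where "M k = (4 * (norm u)\<^sup>2 + (norm (g $ k))\<^sup>2) / 2" for k
  have [measurable]: "F k \<in> borel_measurable borel" for k
    unfolding F_def[abs_def] by measurable
  have [measurable]: "D k \<in> borel_measurable borel" for k
    unfolding D_def[abs_def] by measurable
  have M0: "0 \<le> M k" for k by (simp add: M_def)
  have F1: "\<bar>F k x\<bar> \<le> 1" for k x
    using component_le_norm_cart[of "x - a" k] by (auto simp: F_def divide_le_eq)
  have FI: "integrable lborel (\<lambda>x. (?f x)\<^sup>2 * F k (x + c))" for k c
    by (rule H1_integral_difference_le(1)[OF wg _ F1]) measurable
  have Fle: "(LINT x|lborel. (?f x)\<^sup>2 * (F k x - F k (x - h *\<^sub>R axis k 1))) \<le> h * M k" if "0 \<le> h" for h k
    unfolding M_def by (rule H1_integral_difference_le(2)[OF wg _ F1 that]) measurable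
  have Fshift: "F k (x + s *\<^sub>R axis k 1) = (x $ k - a $ k + s) / sqrt ((x $ k - a $ k + s)\<^sup>2 + (\<Sum>j\<in>UNIV - {k}. ((x - a) $ j)\<^sup>2))"
    for k x s
    using norm_eq_sqrt_coordinate[of "x - a" s k] by (simp add: F_def algebra_simps)
  have Fmono: "F k (x - h *\<^sub>R axis k 1) \<le> F k x" if "0 \<le> h" for k x h
    using Fshift[of k x "- h"] Fshift[of k x 0] that
    by (simp del: vector_minus_component) (intro mono_div_sqrt sum_nonneg, auto)
  have Fderiv: "((\<lambda>s. F k (x + s *\<^sub>R axis k 1)) has_real_derivative D k x) (at 0)" if "x \<noteq> a" for k x
  proof -
    define \<beta> where "\<beta> = (\<Sum>j\<in>UNIV - {k}. ((x - a) $ j)\<^sup>2)"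
    define t where "t = x $ k - a $ k"
    have n: "norm (x - a) = sqrt (t\<^sup>2 + \<beta>)"
      using norm_eq_sqrt_coordinate[of "x - a" 0 k] by (simp add: t_def \<beta>_def)
    with that have pos: "0 < t\<^sup>2 + \<beta>"
      by (metis real_sqrt_gt_0_iff right_minus_eq zero_less_norm_iff)
    have "((\<lambda>s. sqrt ((t + s)\<^sup>2 + \<beta>)) has_real_derivative t / sqrt (t\<^sup>2 + \<beta>)) (at 0)"
      using pos by (auto intro!: derivative_eq_intros simp: field_simps)
    moreover have "((\<lambda>s. t + s) has_real_derivative 1) (at 0)"
      by (auto intro!: derivative_eq_intros)
    ultimately have "((\<lambda>s. (t + s) / sqrt ((t + s)\<^sup>2 + \<beta>)) has_real_derivative
        (1 * sqrt ((t + 0)\<^sup>2 + \<beta>) - (t + 0) * (t / sqrt (t\<^sup>2 + \<beta>))) / (sqrt ((t + 0)\<^sup>2 + \<beta>) * sqrt ((t + 0)\<^sup>2 + \<beta>))) (at 0)"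
      using pos by (intro DERIV_divide) auto
    then have "((\<lambda>s. (t + s) / sqrt ((t + s)\<^sup>2 + \<beta>)) has_real_derivative
        (sqrt (t\<^sup>2 + \<beta>) - t * (t / sqrt (t\<^sup>2 + \<beta>))) / (sqrt (t\<^sup>2 + \<beta>) * sqrt (t\<^sup>2 + \<beta>))) (at 0)"
      by simp
    also have "(sqrt (t\<^sup>2 + \<beta>) - t * (t / sqrt (t\<^sup>2 + \<beta>))) / (sqrt (t\<^sup>2 + \<beta>) * sqrt (t\<^sup>2 + \<beta>)) = D k x"
    proof -
      have "0 < r \<Longrightarrow> (r - t * (t / r)) / (r * r) = 1 / r - t\<^sup>2 / r ^ 3" for r :: real
        by (simp add: field_simps power2_eq_square power3_eq_cube)
      from this[of "sqrt (t\<^sup>2 + \<beta>)"] show ?thesis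
        using pos unfolding D_def n t_def[symmetric] by simp
    qed
    finally show ?thesis unfolding Fshift t_def \<beta>_def .
  qed
  have Dlim: "(\<lambda>n. (F k x - F k (x - inverse (real (Suc n)) *\<^sub>R axis k 1)) / inverse (real (Suc n))) \<longlonglongrightarrow> D k x"
    if "x \<noteq> a" for k x
  proof -
    have "((\<lambda>s. (F k (x + s *\<^sub>R axis k 1) - F k x) / s) \<longlongrightarrow> D k x) (at 0)"
      using Fderiv[OF that] by (simp add: DERIV_def)
    moreover have "filterlim (\<lambda>n. - inverse (real (Suc n))) (at 0) sequentially"
      unfolding filterlim_at using tendsto_minus[OF LIMSEQ_inverse_real_of_nat] by simp
    ultimately have "(\<lambda>n. (F k (x + - inverse (real (Suc n)) *\<^sub>R axis k 1) - F k x) / - inverse (real (Suc n))) \<longlonglongrightarrow> D k x"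
      by (rule filterlim_compose)
    moreover have "(F k (x + - inverse (real (Suc n)) *\<^sub>R axis k 1) - F k x) / - inverse (real (Suc n))
        = (F k x - F k (x - inverse (real (Suc n)) *\<^sub>R axis k 1)) / inverse (real (Suc n))" for n
      by (simp del: of_nat_Suc add: field_simps)
    ultimately show ?thesis by simp
  qed
  have ne: "AE x in lborel. x \<noteq> a" by (rule AE_lborel_singleton)
  have Dint: "(\<integral>\<^sup>+x. ennreal ((?f x)\<^sup>2 * D k x) \<partial>lborel) \<le> ennreal (M k)" for k
  proof -
    define v where "v n x = (?f x)\<^sup>2 * ((F k x - F k (x - inverse (real (Suc n)) *\<^sub>R axis k 1)) / inverse (real (Suc n)))" for n x
    have [measurable]: "v n \<in> borel_measurable borel" for n
      unfolding v_def[abs_def] by measurable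
    have v0: "0 \<le> v n x" for n x
      unfolding v_def using Fmono[of "inverse (real (Suc n))" k x]
      by (intro mult_nonneg_nonneg divide_nonneg_nonneg) auto
    \<comment> \<open>Fatou's lemma: the quotients are nonnegative by \<open>Fmono\<close> and
      converge off the null set consisting of \<open>a\<close>, and after division by
      \<open>h\<close> the bound on their integrals no longer depends on \<open>n\<close>.\<close>
    have "(\<integral>\<^sup>+x. ennreal ((?f x)\<^sup>2 * D k x) \<partial>lborel) = (\<integral>\<^sup>+x. liminf (\<lambda>n. ennreal (v n x)) \<partial>lborel)"
    proof (rule nn_integral_cong_AE, use ne in eventually_elim)
      case (elim x)
      have "(\<lambda>n. ennreal (v n x)) \<longlonglongrightarrow> ennreal ((?f x)\<^sup>2 * D k x)"
        unfolding v_def by (intro tendsto_ennrealI tendsto_mult_left Dlim elim)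
      then show ?case by (simp add: lim_imp_Liminf)
    qed
    also have "\<dots> \<le> liminf (\<lambda>n. \<integral>\<^sup>+x. ennreal (v n x) \<partial>lborel)"
      by (rule nn_integral_liminf) measurable
    also have "\<dots> \<le> liminf (\<lambda>n. ennreal (M k))"
    proof (rule Liminf_mono, rule always_eventually, rule allI)
      fix n
      define h where "h = inverse (real (Suc n))"
      have h: "0 < h" by (simp add: h_def)
      have veq: "v n x = ((?f x)\<^sup>2 * (F k x - F k (x - h *\<^sub>R axis k 1))) / h" for x
        by (simp add: v_def h_def)
      have "integrable lborel (\<lambda>x. (?f x)\<^sup>2 * (F k x - F k (x - h *\<^sub>R axis k 1)))"
        unfolding right_diff_distrib
        using FI[of k 0] FI[of k "- (h *\<^sub>R axis k 1)"]
        by (intro Bochner_Integration.integrable_diff) simp_all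
      then have "(\<integral>\<^sup>+x. ennreal (v n x) \<partial>lborel) = ennreal ((LINT x|lborel. (?f x)\<^sup>2 * (F k x - F k (x - h *\<^sub>R axis k 1))) / h)"
        using v0[of n] unfolding veq by (subst nn_integral_eq_integral) auto
      also have "\<dots> \<le> ennreal (M k)"
        using Fle[of h k] h
        by (intro ennreal_leI) (auto simp: M_def divide_le_eq mult.commute)
      finally show "(\<integral>\<^sup>+x. ennreal (v n x) \<partial>lborel) \<le> ennreal (M k)" .
    qed
    also have "\<dots> = ennreal (M k)" by (simp add: Liminf_const)
    finally show ?thesis .
  qed
  have D0: "0 \<le> D k x" for k x
  proof (cases "x = a")
    case False
    then have n: "0 < norm (x - a)" by simp
    have "\<bar>x $ k - a $ k\<bar>\<^sup>2 \<le> (norm (x - a))\<^sup>2"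
      using component_le_norm_cart[of "x - a" k] by (intro power_mono) auto
    with n show ?thesis unfolding D_def by (simp add: field_simps power2_eq_square power3_eq_cube)
  qed (simp add: D_def)
  \<comment> \<open>The 3 counts the coordinates, and the squares sum to
    \<open>(norm (x - a))\<^sup>2\<close>, which takes one away. At \<open>x = a\<close> division by
    zero makes both sides 0.\<close>
  have sumD: "(\<Sum>k\<in>UNIV. D k x) = 2 / norm (x - a)" for x
  proof (cases "x = a")
    case False
    then have n: "0 < norm (x - a)" by simp
    have "(\<Sum>k\<in>UNIV. (x $ k - a $ k)\<^sup>2) = (norm (x - a))\<^sup>2"
      by (simp add: norm_vec_def L2_set_def sum_nonneg)
    then have "(\<Sum>k\<in>UNIV. D k x) = 3 / norm (x - a) - (norm (x - a))\<^sup>2 / norm (x - a) ^ 3"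
      unfolding D_def by (simp add: sum_subtractf sum_divide_distrib[symmetric])
    also have "\<dots> = 2 / norm (x - a)"
      using n by (simp add: field_simps power2_eq_square power3_eq_cube)
    finally show ?thesis .
  qed (simp add: D_def)
  have "(\<integral>\<^sup>+x. ennreal ((?f x)\<^sup>2 / norm (x - a)) \<partial>lborel) \<le> (\<integral>\<^sup>+x. (\<Sum>k\<in>UNIV. ennreal ((?f x)\<^sup>2 * D k x)) \<partial>lborel)"
  proof (rule nn_integral_mono)
    fix x
    have "(?f x)\<^sup>2 / norm (x - a) \<le> (\<Sum>k\<in>UNIV. (?f x)\<^sup>2 * D k x)"
      unfolding sum_distrib_left[symmetric] sumD by (simp add: divide_right_mono)
    then show "ennreal ((?f x)\<^sup>2 / norm (x - a)) \<le> (\<Sum>k\<in>UNIV. ennreal ((?f x)\<^sup>2 * D k x))"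
      by (subst sum_ennreal) (auto simp: D0 ennreal_leI)
  qed
  also have "\<dots> = (\<Sum>k\<in>UNIV. \<integral>\<^sup>+x. ennreal ((?f x)\<^sup>2 * D k x) \<partial>lborel)"
    by (rule nn_integral_sum) measurable
  also have "\<dots> \<le> (\<Sum>k\<in>UNIV. ennreal (M k))"
    by (intro sum_mono Dint)
  also have "\<dots> = ennreal (\<Sum>k\<in>UNIV. M k)"
    by (simp add: M0 sum_ennreal)
  finally show ?thesis unfolding M_def .
qed

subsection \<open>Coulomb potentials\<close>

text \<open>A single bound for all centres \<open>a\<close> makes the potential of \<open>f\<close>
  a bounded function, which can then be integrated against any integrable function. The extended
  integral lets the inequality carry finiteness with it.\<close>

definition coulomb_bounded :: "(real^3 \<Rightarrow> real) \<Rightarrow> bool" where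
  "coulomb_bounded f \<longleftrightarrow> integrable lborel f \<and>
     (\<exists>M. \<forall>a. (\<integral>\<^sup>+r. ennreal (\<bar>f r\<bar> / norm (a - r)) \<partial>lborel) \<le> ennreal M)"

lemma coulomb_boundedD:
  assumes "coulomb_bounded f"
  shows "f \<in> borel_measurable borel" "integrable lborel f"
    "integrable lborel (\<lambda>r. f r / norm (a - r))"
proof -
  show "integrable lborel f" using assms by (simp add: coulomb_bounded_def)
  then show [measurable]: "f \<in> borel_measurable borel" by auto
  obtain M where "\<And>a. (\<integral>\<^sup>+r. ennreal (\<bar>f r\<bar> / norm (a - r)) \<partial>lborel) \<le> ennreal M"
    using assms by (auto simp: coulomb_bounded_def)
  then show "integrable lborel (\<lambda>r. f r / norm (a - r))"
    by (intro integrableI_bounded) (auto intro: le_less_trans[OF _ ennreal_less_top])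
qed

lemma coulomb_bounded_abs: "coulomb_bounded f \<Longrightarrow> coulomb_bounded (\<lambda>r. \<bar>f r\<bar>)"
  by (simp add: coulomb_bounded_def)

lemma coulomb_bounded_mono:
  assumes "coulomb_bounded g" and [measurable]: "f \<in> borel_measurable borel"
    and le: "AE r in lborel. \<bar>f r\<bar> \<le> \<bar>g r\<bar>"
  shows "coulomb_bounded f"
proof -
  obtain M where M: "\<And>a. (\<integral>\<^sup>+r. ennreal (\<bar>g r\<bar> / norm (a - r)) \<partial>lborel) \<le> ennreal M"
    using assms(1) by (auto simp: coulomb_bounded_def)
  have "(\<integral>\<^sup>+r. ennreal (\<bar>f r\<bar> / norm (a - r)) \<partial>lborel) \<le> (\<integral>\<^sup>+r. ennreal (\<bar>g r\<bar> / norm (a - r)) \<partial>lborel)" for a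
    by (rule nn_integral_mono_AE) (use le in \<open>eventually_elim, auto intro!: ennreal_leI divide_right_mono\<close>)
  moreover have "integrable lborel f"
    using coulomb_boundedD(2)[OF assms(1)] by (rule Bochner_Integration.integrable_bound) (use le in auto)
  ultimately show ?thesis
    using M unfolding coulomb_bounded_def by (meson order_trans)
qed

lemma coulomb_bounded_add:
  assumes f: "coulomb_bounded f" and g: "coulomb_bounded g"
  shows "coulomb_bounded (\<lambda>r. f r + g r)"
proof -
  note [measurable] = coulomb_boundedD(1)[OF f] coulomb_boundedD(1)[OF g]
  obtain M where M: "\<And>a. (\<integral>\<^sup>+r. ennreal (\<bar>f r\<bar> / norm (a - r)) \<partial>lborel) \<le> ennreal M"
    using f by (auto simp: coulomb_bounded_def)
  obtain N where N: "\<And>a. (\<integral>\<^sup>+r. ennreal (\<bar>g r\<bar> / norm (a - r)) \<partial>lborel) \<le> ennreal N"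
    using g by (auto simp: coulomb_bounded_def)
  \<comment> \<open>The obtained \<open>M\<close> and \<open>N\<close> may be negative, where
    \<open>ennreal\<close> gives 0; adding them directly could then lose the bound.\<close>
  have "(\<integral>\<^sup>+r. ennreal (\<bar>f r + g r\<bar> / norm (a - r)) \<partial>lborel) \<le> ennreal (max 0 M + max 0 N)" for a
  proof -
    have "(\<integral>\<^sup>+r. ennreal (\<bar>f r + g r\<bar> / norm (a - r)) \<partial>lborel)
        \<le> (\<integral>\<^sup>+r. ennreal (\<bar>f r\<bar> / norm (a - r)) + ennreal (\<bar>g r\<bar> / norm (a - r)) \<partial>lborel)"
      by (rule nn_integral_mono)
        (auto simp flip: ennreal_plus add_divide_distrib intro!: ennreal_leI divide_right_mono)
    also have "\<dots> = (\<integral>\<^sup>+r. ennreal (\<bar>f r\<bar> / norm (a - r)) \<partial>lborel) + (\<integral>\<^sup>+r. ennreal (\<bar>g r\<bar> / norm (a - r)) \<partial>lborel)"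
      by (rule nn_integral_add) auto
    also have "\<dots> \<le> ennreal (max 0 M + max 0 N)"
      using M[of a] N[of a] by (auto simp: ennreal_plus max_def ennreal_neg intro: add_mono)
    finally show ?thesis .
  qed
  then show ?thesis
    using coulomb_boundedD(2)[OF f] coulomb_boundedD(2)[OF g] unfolding coulomb_bounded_def by blast
qed

lemma coulomb_bounded_cmult:
  assumes f: "coulomb_bounded f"
  shows "coulomb_bounded (\<lambda>r. c * f r)"
proof -
  note [measurable] = coulomb_boundedD(1)[OF f]
  obtain M where M: "\<And>a. (\<integral>\<^sup>+r. ennreal (\<bar>f r\<bar> / norm (a - r)) \<partial>lborel) \<le> ennreal M"
    using f by (auto simp: coulomb_bounded_def)
  have "(\<integral>\<^sup>+r. ennreal (\<bar>c * f r\<bar> / norm (a - r)) \<partial>lborel) \<le> ennreal (\<bar>c\<bar> * M)" for a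
  proof -
    have "(\<integral>\<^sup>+r. ennreal (\<bar>c * f r\<bar> / norm (a - r)) \<partial>lborel)
        = (\<integral>\<^sup>+r. ennreal \<bar>c\<bar> * ennreal (\<bar>f r\<bar> / norm (a - r)) \<partial>lborel)"
      by (rule nn_integral_cong) (simp add: abs_mult ennreal_mult[symmetric])
    also have "\<dots> = ennreal \<bar>c\<bar> * (\<integral>\<^sup>+r. ennreal (\<bar>f r\<bar> / norm (a - r)) \<partial>lborel)"
      by (rule nn_integral_cmult) auto
    also have "\<dots> \<le> ennreal (\<bar>c\<bar> * M)"
      using M[of a] by (auto simp: ennreal_mult' intro: mult_left_mono)
    finally show ?thesis .
  qed
  then show ?thesis
    using coulomb_boundedD(2)[OF f] unfolding coulomb_bounded_def by auto
qed

lemma coulomb_bounded_sum: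
  assumes "\<And>p. p \<in> P \<Longrightarrow> coulomb_bounded (f p)"
  shows "coulomb_bounded (\<lambda>r. \<Sum>p\<in>P. f p r)"
  using assms
proof (induction P rule: infinite_finite_induct)
  case (insert p P)
  then show ?case by (simp add: coulomb_bounded_add)
qed (auto simp: coulomb_bounded_def)

text \<open>The Hardy inequality enters here: its constant depends on \<open>u\<close> and its weak
  gradient but not on the centre. Mixed products are dominated by sums of squares.\<close>

lemma coulomb_bounded_H1_mult:
  assumes "u \<in> H1" "v \<in> H1"
  shows "coulomb_bounded (\<lambda>r. rep_L2 u r * rep_L2 v r)"
proof -
  have sq: "coulomb_bounded (\<lambda>r. (rep_L2 w r)\<^sup>2)" if w: "w \<in> H1" for w
  proof -
    obtain M where "\<And>a. (\<integral>\<^sup>+r. ennreal ((rep_L2 w r)\<^sup>2 / norm (r - a)) \<partial>lborel) \<le> ennreal M"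
      using H1_nn_integral_over_distance_le[OF has_weak_gradient_weak_gradient[OF w]] that by blast
    then show ?thesis
      using L2_relD(2)[OF sq_integrable_rep[of w]] unfolding coulomb_bounded_def
      by (auto simp: norm_minus_commute)
  qed
  show ?thesis
  proof (rule coulomb_bounded_mono)
    show "coulomb_bounded (\<lambda>r. (rep_L2 u r)\<^sup>2 + (rep_L2 v r)\<^sup>2)"
      by (intro coulomb_bounded_add sq assms)
    have "\<bar>x * y\<bar> \<le> \<bar>x\<^sup>2 + y\<^sup>2\<bar>" for x y :: real
      using two_abs_mult_le[of x y] abs_ge_zero[of "x * y"] by linarith
    then show "AE r in lborel. \<bar>rep_L2 u r * rep_L2 v r\<bar> \<le> \<bar>(rep_L2 u r)\<^sup>2 + (rep_L2 v r)\<^sup>2\<bar>"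
      by auto
  qed measurable
qed

section \<open>Hartree potentials and their pairings\<close>

lemma hartree_potential_measurable [measurable]:
  assumes [measurable]: "f \<in> borel_measurable borel"
  shows "hartree_potential f \<in> borel_measurable borel"
  unfolding hartree_potential_def by measurable

lemma hartree_potential_bounded:
  assumes f: "coulomb_bounded f"
  obtains B where "\<And>r. \<bar>hartree_potential f r\<bar> \<le> B"
proof -
  obtain M where M: "\<And>a. (\<integral>\<^sup>+r. ennreal (\<bar>f r\<bar> / norm (a - r)) \<partial>lborel) \<le> ennreal M"
    using f by (auto simp: coulomb_bounded_def)
  have "\<bar>hartree_potential f a\<bar> \<le> max 0 M" for a
  proof -
    have "ennreal \<bar>hartree_potential f a\<bar> \<le> ennreal (LINT r|lborel. \<bar>f r / norm (a - r)\<bar>)"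
      unfolding hartree_potential_def by (intro ennreal_leI integral_abs_bound)
    also have "\<dots> = (\<integral>\<^sup>+r. ennreal (\<bar>f r\<bar> / norm (a - r)) \<partial>lborel)"
      using nn_integral_eq_integral[OF integrable_abs[OF coulomb_boundedD(3)[OF f, of a]]] by simp
    also have "\<dots> \<le> ennreal (max 0 M)"
      using M[of a] by (rule order_trans) (simp add: ennreal_leI)
    finally show ?thesis by (simp add: ennreal_le_iff)
  qed
  then show ?thesis by (rule that)
qed

lemma integrable_mult_hartree_potential:
  assumes f: "coulomb_bounded f" and g: "integrable lborel g"
  shows "integrable lborel (\<lambda>r. hartree_potential f r * g r)"
proof -
  have [measurable]: "f \<in> borel_measurable borel" "g \<in> borel_measurable borel"
    using coulomb_boundedD(1)[OF f] g by auto
  obtain B where B: "\<And>r. \<bar>hartree_potential f r\<bar> \<le> B" using hartree_potential_bounded[OF f] by blast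
  show ?thesis
  proof (rule Bochner_Integration.integrable_bound)
    show "integrable lborel (\<lambda>r. B * \<bar>g r\<bar>)" using g by simp
    have "\<bar>hartree_potential f r\<bar> * \<bar>g r\<bar> \<le> \<bar>B\<bar> * \<bar>g r\<bar>" for r
      using B[of r] by (intro mult_right_mono) auto
    then show "AE r in lborel. norm (hartree_potential f r * g r) \<le> norm (B * \<bar>g r\<bar>)"
      by (simp add: abs_mult)
  qed measurable
qed

lemma hartree_potential_cong_AE:
  assumes [measurable]: "f \<in> borel_measurable borel" "g \<in> borel_measurable borel"
    and "AE r in lborel. f r = g r"
  shows "hartree_potential f = hartree_potential g"
  unfolding hartree_potential_def
  by (rule ext, rule integral_cong_AE) (use assms(3) in auto)

lemma hartree_potential_sum:
  assumes "\<And>p. p \<in> P \<Longrightarrow> coulomb_bounded (f p)"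
  shows "hartree_potential (\<lambda>r. \<Sum>p\<in>P. y p * f p r) r = (\<Sum>p\<in>P. y p * hartree_potential (f p) r)"
proof -
  have "hartree_potential (\<lambda>r. \<Sum>p\<in>P. y p * f p r) r = (LINT r'|lborel. (\<Sum>p\<in>P. y p * (f p r' / norm (r - r'))))"
    by (simp add: hartree_potential_def sum_divide_distrib)
  also have "\<dots> = (\<Sum>p\<in>P. LINT r'|lborel. y p * (f p r' / norm (r - r')))"
    by (rule Bochner_Integration.integral_sum)
      (intro integrable_mult_right coulomb_boundedD(3) assms)
  finally show ?thesis by (simp add: hartree_potential_def del: times_divide_eq_right)
qed

text \<open>Fubini together with the symmetry of the kernel. Integrability on the product space
  holds because the potential of \<open>\<bar>f\<bar>\<close> is bounded and \<open>g\<close> is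
  integrable.\<close>

lemma hartree_potential_symmetric:
  assumes f: "coulomb_bounded f" and g: "coulomb_bounded g"
  shows "(LINT r|lborel. hartree_potential f r * g r) = (LINT r|lborel. hartree_potential g r * f r)"
proof -
  note [measurable] = coulomb_boundedD(1)[OF f] coulomb_boundedD(1)[OF g]
  have int: "integrable (lborel \<Otimes>\<^sub>M lborel) (\<lambda>(r, r'). g r * (f r' / norm (r - r')))"
  proof (rule lborel_pair.Fubini_integrable)
    have "(\<lambda>r. LINT r'|lborel. norm (g r * (f r' / norm (r - r')))) = (\<lambda>r. hartree_potential (\<lambda>r. \<bar>f r\<bar>) r * \<bar>g r\<bar>)"
      by (simp add: hartree_potential_def abs_mult mult.commute del: times_divide_eq_right times_divide_eq_left)
    then show "integrable lborel (\<lambda>r. LINT r'|lborel. norm (case (r, r') of (r, r') \<Rightarrow> g r * (f r' / norm (r - r'))))"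
      using integrable_mult_hartree_potential[OF coulomb_bounded_abs[OF f] integrable_abs[OF coulomb_boundedD(2)[OF g]]]
      by simp
    show "AE r in lborel. integrable lborel (\<lambda>r'. case (r, r') of (r, r') \<Rightarrow> g r * (f r' / norm (r - r')))"
      using coulomb_boundedD(3)[OF f] by (auto intro!: AE_I2 integrable_mult_right simp del: times_divide_eq_right)
  qed measurable
  have "(LINT r|lborel. hartree_potential f r * g r) = (LINT r|lborel. LINT r'|lborel. g r * (f r' / norm (r - r')))"
    by (simp only: hartree_potential_def integral_mult_right_zero mult.commute)
  also have "\<dots> = (LINT r'|lborel. LINT r|lborel. g r * (f r' / norm (r - r')))"
    by (rule lborel_pair.Fubini_integral[OF int, symmetric])
  also have "\<dots> = (LINT r'|lborel. LINT r|lborel. f r' * (g r / norm (r' - r)))"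
    by (simp add: norm_minus_commute mult.commute)
  also have "\<dots> = (LINT r|lborel. hartree_potential g r * f r)"
    by (simp only: hartree_potential_def integral_mult_right_zero mult.commute)
  finally show ?thesis .
qed

lemma hartree_energy_eq: "hartree_energy \<rho> = 1 / 2 * (LINT r|lborel. hartree_potential \<rho> r * \<rho> r)"
proof -
  have "hartree_energy \<rho> = 1 / 2 * (LINT r|lborel. LINT r'|lborel. \<rho> r * (\<rho> r' / norm (r - r')))"
    by (simp add: hartree_energy_def)
  also have "\<dots> = 1 / 2 * (LINT r|lborel. \<rho> r * hartree_potential \<rho> r)"
    by (simp only: hartree_potential_def integral_mult_right_zero)
  finally show ?thesis by (simp add: mult.commute)
qed

subsection \<open>Forms on finite-dimensional spaces\<close>

definition coord :: "'a::real_inner \<Rightarrow> 'a \<Rightarrow> real" where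
  "coord c v = inner v c / inner c c"

lemma orthogonal_basis_exists:
  fixes B :: "'a::real_inner set"
  assumes "finite B"
  obtains C where "finite C" "span C = span B" "\<And>v. v \<in> span B \<Longrightarrow> v = (\<Sum>c\<in>C. coord c v *\<^sub>R c)"
proof -
  obtain C where C: "finite C" "span C = span B" "pairwise orthogonal C"
    using basis_orthogonal[OF assms] by blast
  have "v = (\<Sum>c\<in>C. coord c v *\<^sub>R c)" if v: "v \<in> span B" for v
  proof -
    obtain a where a: "v = (\<Sum>c\<in>C. a c *\<^sub>R c)"
      using v unfolding C(2)[symmetric] span_finite[OF C(1)] by blast
    have "inner v c = a c * inner c c" if "c \<in> C" for c
    proof -
      have "inner v c = (\<Sum>d\<in>C. a d * inner d c)" by (simp add: a inner_sum_left)
      also have "\<dots> = (\<Sum>d\<in>C. if d = c then a c * inner c c else 0)"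
        using C(3) that by (intro sum.cong) (auto simp: pairwise_def orthogonal_def)
      finally show ?thesis using C(1) that by simp
    qed
    \<comment> \<open>The orthogonal family may contain 0; then \<open>coord\<close> divides by
      zero, but both multiples of \<open>c\<close> are 0 anyway.\<close>
    then have "coord c v *\<^sub>R c = a c *\<^sub>R c" if "c \<in> C" for c
      using that by (cases "c = 0") (auto simp: coord_def)
    then have "(\<Sum>c\<in>C. coord c v *\<^sub>R c) = (\<Sum>c\<in>C. a c *\<^sub>R c)"
      by (rule sum.cong[OF refl])
    then show ?thesis using a by simp
  qed
  with C show ?thesis using that by blast
qed

text \<open>Linearity is relative to \<open>V\<close>, because the integrals behind the forms are
  known to converge only for functions in \<open>V\<close>.\<close>

definition linear_form_on :: "'a::real_vector set \<Rightarrow> ('a \<Rightarrow> real) \<Rightarrow> bool" where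
  "linear_form_on V f \<longleftrightarrow> (\<forall>u\<in>V. \<forall>v\<in>V. \<forall>a b. f (a *\<^sub>R u + b *\<^sub>R v) = a * f u + b * f v)"

lemma linear_form_onI:
  "(\<And>u v a b. u \<in> V \<Longrightarrow> v \<in> V \<Longrightarrow> f (a *\<^sub>R u + b *\<^sub>R v) = a * f u + b * f v) \<Longrightarrow> linear_form_on V f"
  by (simp add: linear_form_on_def)

lemma linear_form_onD:
  "linear_form_on V f \<Longrightarrow> u \<in> V \<Longrightarrow> v \<in> V \<Longrightarrow> f (a *\<^sub>R u + b *\<^sub>R v) = a * f u + b * f v"
  by (simp add: linear_form_on_def)

lemma linear_form_on_add:
  "linear_form_on V f \<Longrightarrow> linear_form_on V g \<Longrightarrow> linear_form_on V (\<lambda>v. f v + g v)"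
  by (auto simp: linear_form_on_def algebra_simps)

lemma linear_form_on_cmult: "linear_form_on V f \<Longrightarrow> linear_form_on V (\<lambda>v. c * f v)"
  by (auto simp: linear_form_on_def algebra_simps)

lemma linear_form_on_sum:
  assumes f: "linear_form_on V f" and V: "subspace V" and "finite C" "\<And>c. c \<in> C \<Longrightarrow> v c \<in> V"
  shows "f (\<Sum>c\<in>C. a c *\<^sub>R v c) = (\<Sum>c\<in>C. a c * f (v c))"
  using assms(3,4)
proof (induction C rule: finite_induct)
  case empty
  have "f (0 *\<^sub>R 0 + 0 *\<^sub>R 0) = 0 * f 0 + 0 * f 0"
    by (intro linear_form_onD[OF f] subspace_0[OF V])
  then show ?case by simp
next
  case (insert c C)
  have "f (a c *\<^sub>R v c + 1 *\<^sub>R (\<Sum>c\<in>C. a c *\<^sub>R v c)) = a c * f (v c) + 1 * f (\<Sum>c\<in>C. a c *\<^sub>R v c)"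
    by (intro linear_form_onD[OF f] subspace_sum[OF V] subspace_scale[OF V] insert) (use insert in auto)
  then show ?case using insert by simp
qed

locale orthogonal_basis =
  fixes V C :: "'a::real_inner set"
  assumes subspace_V: "subspace V" and finite_C: "finite C" and C_subset: "C \<subseteq> V"
    and expand: "\<And>v. v \<in> V \<Longrightarrow> v = (\<Sum>c\<in>C. coord c v *\<^sub>R c)"
begin

lemma linear_form_expand: "linear_form_on V f \<Longrightarrow> v \<in> V \<Longrightarrow> f v = (\<Sum>c\<in>C. coord c v * f c)"
  by (subst expand, assumption) (rule linear_form_on_sum[OF _ subspace_V finite_C], use C_subset in auto)

text \<open>Existence and uniqueness within \<open>V\<close> are exactly what the definite
  description of the gradient asks for. The representative is explicit in the orthogonal family, and
  the difference of two representatives is orthogonal to itself.\<close>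

lemma riesz_representation:
  assumes f: "linear_form_on V f"
  shows "\<exists>!g. g \<in> V \<and> (\<forall>v\<in>V. inner g v = f v)"
proof (rule ex1I)
  define g where "g = (\<Sum>c\<in>C. (f c / inner c c) *\<^sub>R c)"
  have "g \<in> V"
    unfolding g_def using C_subset by (intro subspace_sum[OF subspace_V] subspace_scale[OF subspace_V]) auto
  moreover have "inner g v = f v" if "v \<in> V" for v
    unfolding linear_form_expand[OF f that] g_def
    by (simp add: inner_sum_left coord_def inner_commute[of v] mult.commute)
  ultimately show "g \<in> V \<and> (\<forall>v\<in>V. inner g v = f v)" by blast
  fix g' assume g': "g' \<in> V \<and> (\<forall>v\<in>V. inner g' v = f v)"
  have "inner (g' - g) (g' - g) = 0"
    using g' \<open>g \<in> V\<close> \<open>\<And>v. v \<in> V \<Longrightarrow> inner g v = f v\<close> subspace_diff[OF subspace_V, of g' g]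
    by (simp add: inner_diff_left)
  then show "g' = g" by simp
qed

lemma coord_deriv:
  assumes "(x has_vector_derivative x') (at t)"
  shows "((\<lambda>s. coord c (x s)) has_real_derivative coord c x') (at t)"
  unfolding coord_def has_real_derivative_iff_has_vector_derivative
  by (intro has_vector_derivative_divide bounded_linear.has_vector_derivative[OF bounded_linear_inner_left] assms)

lemma bilinear_expand:
  assumes "\<And>u. u \<in> V \<Longrightarrow> linear_form_on V (Q u)" and "\<And>v. v \<in> V \<Longrightarrow> linear_form_on V (\<lambda>u. Q u v)"
    and "u \<in> V" "v \<in> V"
  shows "Q u v = (\<Sum>c\<in>C. \<Sum>d\<in>C. coord c u * coord d v * Q c d)"
proof -
  have "Q u v = (\<Sum>c\<in>C. coord c u * Q c v)"
    using linear_form_expand[OF assms(2,3)] assms(4) by simp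
  also have "\<dots> = (\<Sum>c\<in>C. coord c u * (\<Sum>d\<in>C. coord d v * Q c d))"
    using C_subset assms(4) by (intro sum.cong refl arg_cong2[where f="(*)"] linear_form_expand[OF assms(1)]) auto
  finally show ?thesis by (simp add: sum_distrib_left mult.assoc)
qed

text \<open>The form may be unbounded for the norm of the ambient space, as the pairing of weak
  gradients is for the \<open>L\<^sup>2\<close> norm. On \<open>V\<close> it is a polynomial in
  finitely many coordinates, each a bounded linear functional and hence differentiable along the
  curve.\<close>

lemma quadratic_form_deriv:
  assumes lin: "\<And>u. u \<in> V \<Longrightarrow> linear_form_on V (Q u)" and sym: "\<And>u v. Q u v = Q v u"
    and x: "(x has_vector_derivative x') (at t)" "x' \<in> V"
    and S: "open S" "t \<in> S" "\<And>s. s \<in> S \<Longrightarrow> x s \<in> V"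
  shows "((\<lambda>s. Q (x s) (x s)) has_real_derivative 2 * Q (x t) x') (at t)"
proof -
  have lin': "linear_form_on V (\<lambda>u. Q u v)" if "v \<in> V" for v
    using lin[OF that] unfolding sym[of v] .
  have "((\<lambda>s. \<Sum>c\<in>C. \<Sum>d\<in>C. coord c (x s) * coord d (x s) * Q c d) has_real_derivative
      (\<Sum>c\<in>C. \<Sum>d\<in>C. (coord c x' * coord d (x t) + coord d x' * coord c (x t)) * Q c d)) (at t)"
    by (intro DERIV_sum DERIV_cmult_right DERIV_mult coord_deriv x)
  also have "(\<Sum>c\<in>C. \<Sum>d\<in>C. (coord c x' * coord d (x t) + coord d x' * coord c (x t)) * Q c d)
      = Q x' (x t) + Q (x t) x'"
    using bilinear_expand[OF lin lin' x(2) S(3)[OF S(2)]] bilinear_expand[OF lin lin' S(3)[OF S(2)] x(2)]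
    by (simp add: algebra_simps sum.distrib)
  also have "\<dots> = 2 * Q (x t) x'" using sym[of x' "x t"] by simp
  finally show ?thesis
    by (rule has_field_derivative_transform_within_open[OF _ S(1,2)])
      (rule bilinear_expand[OF lin lin', symmetric], auto intro: S)
qed

end

section \<open>Kinetic and multiplication forms, and the exchange-correlation chain rule\<close>

lemma has_vector_derivative_vec_nth:
  fixes U :: "real \<Rightarrow> 'a::real_normed_vector ^ 'n"
  shows "(U has_vector_derivative U') F \<Longrightarrow> ((\<lambda>s. U s $ i) has_vector_derivative U' $ i) F"
  by (rule bounded_linear.has_vector_derivative[OF bounded_linear_vec_nth])

lemma inner_weak_gradient_linear:
  assumes "V \<subseteq> H1" "u \<in> V"
  shows "linear_form_on V (\<lambda>v. inner (weak_gradient u) (weak_gradient v))"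
  using assms by (intro linear_form_onI) (auto simp: weak_gradient_linear subset_eq inner_add_right)

text \<open>External, Hartree and exchange-correlation potentials all act by multiplication, so one
  calculus for a general weight serves all three.\<close>

definition weight_form :: "(real^3 \<Rightarrow> real) \<Rightarrow> L2 \<Rightarrow> L2 \<Rightarrow> real" where
  "weight_form W u v = (LINT r|lborel. W r * rep_L2 u r * rep_L2 v r)"

definition admissible_weight :: "L2 set \<Rightarrow> (real^3 \<Rightarrow> real) \<Rightarrow> bool" where
  "admissible_weight V W \<longleftrightarrow> (\<forall>u\<in>V. \<forall>v\<in>V. integrable lborel (\<lambda>r. W r * rep_L2 u r * rep_L2 v r))"

lemma weight_form_commute: "weight_form W u v = weight_form W v u"
  by (simp add: weight_form_def ac_simps)

lemma weight_form_linear: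
  assumes W: "admissible_weight V W" and "subspace V" "w \<in> V"
  shows "linear_form_on V (weight_form W w)"
proof (rule linear_form_onI)
  fix u v and a b :: real assume uv: "u \<in> V" "v \<in> V"
  then have I: "integrable lborel (\<lambda>r. W r * rep_L2 w r * rep_L2 u r)" "integrable lborel (\<lambda>r. W r * rep_L2 w r * rep_L2 v r)"
    "integrable lborel (\<lambda>r. W r * rep_L2 w r * rep_L2 (a *\<^sub>R u + b *\<^sub>R v) r)"
    using assms by (auto simp: admissible_weight_def subspace_add subspace_scale)
  have "weight_form W w (a *\<^sub>R u + b *\<^sub>R v) =
      (LINT r|lborel. a * (W r * rep_L2 w r * rep_L2 u r) + b * (W r * rep_L2 w r * rep_L2 v r))"
    unfolding weight_form_def
  proof (rule integral_cong_AE)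
    show "AE r in lborel. W r * rep_L2 w r * rep_L2 (a *\<^sub>R u + b *\<^sub>R v) r =
       a * (W r * rep_L2 w r * rep_L2 u r) + b * (W r * rep_L2 w r * rep_L2 v r)"
      using rep_L2_linear[of a u b v] by eventually_elim (simp add: algebra_simps)
  qed (use I in auto)
  also have "\<dots> = a * weight_form W w u + b * weight_form W w v"
    using I(1,2) by (simp add: weight_form_def)
  finally show "weight_form W w (a *\<^sub>R u + b *\<^sub>R v) = a * weight_form W w u + b * weight_form W w v" .
qed

text \<open>A chain rule on a set \<open>D\<close> of densities: the remainder of the linearization
  is small relative to the \<open>L\<^sup>1\<close> distance from \<open>\<rho> t\<close>, and by
  \<open>lip\<close> and the differentiability of the coefficients that distance is at most a
  constant times \<open>\<bar>s - t\<bar>\<close>. The linear part, with the potential frozen at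
  \<open>t\<close>, contributes its own derivative \<open>A'\<close>.\<close>

lemma has_real_derivative_xc_energy:
  assumes xc: "has_xc_potential D \<epsilon>xc vxc" and \<rho>: "open S" "t \<in> S" "\<And>s. s \<in> S \<Longrightarrow> \<rho> s \<in> D"
    and lip: "\<And>s. s \<in> S \<Longrightarrow> (LINT r|lborel. \<bar>\<rho> s r - \<rho> t r\<bar>) \<le> (\<Sum>p\<in>P. \<bar>y p s - y p t\<bar> * N p)"
    and N: "\<And>p. 0 \<le> N p"
    and y: "\<And>p. p \<in> P \<Longrightarrow> (y p has_real_derivative y' p) (at t)"
    and A: "((\<lambda>s. LINT r|lborel. vxc (\<rho> t) r * \<rho> s r) has_real_derivative A') (at t)"
  shows "((\<lambda>s. xc_energy \<epsilon>xc (\<rho> s)) has_real_derivative A') (at t)"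
proof -
  let ?A = "\<lambda>s. LINT r|lborel. vxc (\<rho> t) r * \<rho> s r"
  let ?R = "\<lambda>s. xc_energy \<epsilon>xc (\<rho> s) - ?A s"
  let ?L = "\<lambda>s. LINT r|lborel. \<bar>\<rho> s r - \<rho> t r\<bar>"
  have int: "integrable lborel (\<lambda>r. vxc (\<rho> t) r * \<rho> s r)" if "s \<in> S" for s
    using xc \<rho> that by (auto simp: has_xc_potential_def)
  \<comment> \<open>Near \<open>t\<close> the difference quotient of \<open>y p\<close> stays below
    \<open>\<bar>y' p\<bar> + 1\<close>. The last summand 1 keeps \<open>K\<close> positive, so that
    one may divide by it.\<close>
  define K where "K = (\<Sum>p\<in>P. (\<bar>y' p\<bar> + 1) * N p) + 1"
  have K: "0 < K" unfolding K_def using N by (intro add_nonneg_pos sum_nonneg) auto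
  have evS: "\<forall>\<^sub>F s in at t. s \<in> S" using \<rho>(1,2) by (simp add: eventually_at_topological) blast
  have evy: "\<forall>\<^sub>F s in at t. \<bar>y p s - y p t\<bar> \<le> (\<bar>y' p\<bar> + 1) * \<bar>s - t\<bar>" if "p \<in> P" for p
  proof -
    have "((\<lambda>s. \<bar>(y p s - y p t) / (s - t)\<bar>) \<longlongrightarrow> \<bar>y' p\<bar>) (at t)"
      using y[OF that] by (intro tendsto_rabs) (simp add: has_field_derivative_iff)
    then have "\<forall>\<^sub>F s in at t. \<bar>(y p s - y p t) / (s - t)\<bar> < \<bar>y' p\<bar> + 1"
      by (rule order_tendstoD) simp
    moreover have "\<forall>\<^sub>F s in at t. s \<noteq> t" by (simp add: eventually_at_filter)
    ultimately show ?thesis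
      by eventually_elim (simp add: abs_divide divide_less_eq split: if_splits)
  qed
  have evL: "\<forall>\<^sub>F s in at t. ?L s \<le> K * \<bar>s - t\<bar>"
  proof (cases "finite P")
    case True
    then have "\<forall>\<^sub>F s in at t. \<forall>p\<in>P. \<bar>y p s - y p t\<bar> \<le> (\<bar>y' p\<bar> + 1) * \<bar>s - t\<bar>"
      using evy by (simp add: eventually_ball_finite)
    with evS show ?thesis
    proof eventually_elim
      case (elim s)
      have "?L s \<le> (\<Sum>p\<in>P. \<bar>y p s - y p t\<bar> * N p)" using lip elim by blast
      also have "\<dots> \<le> (\<Sum>p\<in>P. ((\<bar>y' p\<bar> + 1) * \<bar>s - t\<bar>) * N p)"
        using elim N by (intro sum_mono mult_right_mono) auto
      also have "\<dots> = (K - 1) * \<bar>s - t\<bar>"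
        by (simp add: K_def sum_distrib_left sum_distrib_right ac_simps)
      also have "\<dots> \<le> K * \<bar>s - t\<bar>" by (intro mult_right_mono) auto
      finally show ?case .
    qed
  next
    \<comment> \<open>A sum over an infinite set is 0 by convention, so \<open>lip\<close> then
      forces the distance to vanish.\<close>
    case False
    from evS show ?thesis
    proof eventually_elim
      case (elim s)
      then have "?L s \<le> 0" using lip[OF elim] False by simp
      also have "0 \<le> K * \<bar>s - t\<bar>" using K by simp
      finally show ?case .
    qed
  qed
  have "((\<lambda>s. (?R s - ?R t) / (s - t)) \<longlongrightarrow> 0) (at t)"
  proof (rule tendstoI)
    fix e :: real assume e: "0 < e"
    define e' where "e' = e / (2 * K)"
    have e': "0 < e'" using e K by (simp add: e'_def)
    obtain d where d: "0 < d" and dd: "\<And>\<sigma>. \<sigma> \<in> D \<Longrightarrow> (LINT r|lborel. \<bar>\<sigma> r - \<rho> t r\<bar>) < d \<Longrightarrow>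
        \<bar>xc_energy \<epsilon>xc \<sigma> - xc_energy \<epsilon>xc (\<rho> t) - (LINT r|lborel. vxc (\<rho> t) r * (\<sigma> r - \<rho> t r))\<bar>
             \<le> e' * (LINT r|lborel. \<bar>\<sigma> r - \<rho> t r\<bar>)"
      using xc \<rho>(3)[OF \<rho>(2)] e' unfolding has_xc_potential_def by meson
    have "((\<lambda>s. K * \<bar>s - t\<bar>) \<longlongrightarrow> K * \<bar>t - t\<bar>) (at t)" by (intro tendsto_intros)
    then have "\<forall>\<^sub>F s in at t. K * \<bar>s - t\<bar> < d"
      using d by (intro order_tendstoD) simp_all
    moreover have "\<forall>\<^sub>F s in at t. s \<noteq> t" by (simp add: eventually_at_filter)
    ultimately show "\<forall>\<^sub>F s in at t. dist ((?R s - ?R t) / (s - t)) 0 < e"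
      using evL evS
    proof eventually_elim
      case (elim s)
      have "(LINT r|lborel. vxc (\<rho> t) r * (\<rho> s r - \<rho> t r)) = ?A s - ?A t"
        unfolding right_diff_distrib using int[OF elim(4)] int[OF \<rho>(2)] by simp
      then have "\<bar>?R s - ?R t\<bar> \<le> e' * ?L s"
        using dd[OF \<rho>(3)[OF elim(4)]] elim(1,3) by (simp add: algebra_simps)
      also have "\<dots> \<le> e' * (K * \<bar>s - t\<bar>)" using e' elim(3) by (intro mult_left_mono) auto
      also have "\<dots> = e / 2 * \<bar>s - t\<bar>" using K by (simp add: e'_def)
      finally have "\<bar>?R s - ?R t\<bar> / \<bar>s - t\<bar> \<le> e / 2"
        using elim(2) by (subst pos_divide_le_eq) auto
      then have "\<bar>?R s - ?R t\<bar> / \<bar>s - t\<bar> < e" using e by linarith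
      then show ?case by (simp only: dist_real_def diff_0_right abs_divide)
    qed
  qed
  then have "(?R has_real_derivative 0) (at t)"
    by (simp add: has_field_derivative_iff)
  from DERIV_add[OF this A] show ?thesis by simp
qed

subsection \<open>The energy and its gradient\<close>

lemma hartree_potential_expand:
  assumes f: "\<And>p. p \<in> P \<Longrightarrow> coulomb_bounded (f p)"
    and [measurable]: "\<rho> \<in> borel_measurable borel" "\<sigma> \<in> borel_measurable borel"
    and \<rho>: "AE r in lborel. \<rho> r = (\<Sum>p\<in>P. y p * f p r)"
    and \<sigma>: "AE r in lborel. \<sigma> r = (\<Sum>p\<in>P. z p * f p r)"
  shows "(LINT r|lborel. hartree_potential \<rho> r * \<sigma> r)
    = (\<Sum>p\<in>P. \<Sum>q\<in>P. y p * z q * (LINT r|lborel. hartree_potential (f p) r * f q r))"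
proof -
  have [measurable]: "(\<lambda>r. \<Sum>p\<in>P. w p * f p r) \<in> borel_measurable borel" for w
    by (intro borel_measurable_sum borel_measurable_times borel_measurable_const coulomb_boundedD(1) f)
  have int: "integrable lborel (\<lambda>r. hartree_potential (f p) r * f q r)" if "p \<in> P" "q \<in> P" for p q
    by (intro integrable_mult_hartree_potential coulomb_boundedD(2) f that)
  have "hartree_potential \<rho> = hartree_potential (\<lambda>r. \<Sum>p\<in>P. y p * f p r)"
    by (rule hartree_potential_cong_AE[OF _ _ \<rho>]) measurable
  also have "\<dots> = (\<lambda>r. \<Sum>p\<in>P. y p * hartree_potential (f p) r)"
    by (rule ext) (rule hartree_potential_sum[OF f])
  finally have hp: "hartree_potential \<rho> = (\<lambda>r. \<Sum>p\<in>P. y p * hartree_potential (f p) r)" .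
  have "(LINT r|lborel. hartree_potential \<rho> r * \<sigma> r) = (LINT r|lborel. hartree_potential \<rho> r * (\<Sum>p\<in>P. z p * f p r))"
    by (rule integral_cong_AE) (measurable, use \<sigma> in auto)
  also have "\<dots> = (LINT r|lborel. (\<Sum>p\<in>P. \<Sum>q\<in>P. y p * z q * (hartree_potential (f p) r * f q r)))"
    unfolding hp sum_product by (simp add: ac_simps)
  also have "\<dots> = (\<Sum>p\<in>P. \<Sum>q\<in>P. y p * z q * (LINT r|lborel. hartree_potential (f p) r * f q r))"
    using int by (simp add: Bochner_Integration.integral_sum)
  finally show ?thesis .
qed

text \<open>The energy is half a symmetric quadratic form in the coefficients \<open>y p\<close>, so
  its derivative equals that of the pairing with the potential frozen at \<open>t\<close>. Taking
  the latter as hypothesis \<open>A\<close> keeps the result in the form of a weight; uniqueness of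
  derivatives identifies \<open>A'\<close> with the expression in coordinates.\<close>

lemma has_real_derivative_hartree_energy:
  assumes f: "\<And>p. p \<in> P \<Longrightarrow> coulomb_bounded (f p)" and S: "open S" "t \<in> S"
    and [measurable]: "\<And>s. \<rho> s \<in> borel_measurable borel"
    and \<rho>: "\<And>s. s \<in> S \<Longrightarrow> AE r in lborel. \<rho> s r = (\<Sum>p\<in>P. y p s * f p r)"
    and y: "\<And>p. p \<in> P \<Longrightarrow> (y p has_real_derivative y' p) (at t)"
    and A: "((\<lambda>s. LINT r|lborel. hartree_potential (\<rho> t) r * \<rho> s r) has_real_derivative A') (at t)"
  shows "((\<lambda>s. hartree_energy (\<rho> s)) has_real_derivative A') (at t)"
proof -
  define K where "K p q = (LINT r|lborel. hartree_potential (f p) r * f q r)" for p q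
  have K: "K p q = K q p" if "p \<in> P" "q \<in> P" for p q
    unfolding K_def by (rule hartree_potential_symmetric[OF f f]) fact+
  have "((\<lambda>s. \<Sum>p\<in>P. \<Sum>q\<in>P. y p t * y q s * K p q) has_real_derivative
      (\<Sum>p\<in>P. \<Sum>q\<in>P. y p t * y' q * K p q)) (at t)"
    by (intro DERIV_sum DERIV_cmult_right DERIV_cmult y)
  then have "((\<lambda>s. LINT r|lborel. hartree_potential (\<rho> t) r * \<rho> s r) has_real_derivative
      (\<Sum>p\<in>P. \<Sum>q\<in>P. y p t * y' q * K p q)) (at t)"
    by (rule has_field_derivative_transform_within_open[OF _ S])
      (simp add: hartree_potential_expand[OF f _ _ \<rho>[OF S(2)] \<rho>] K_def)
  with A have A': "A' = (\<Sum>p\<in>P. \<Sum>q\<in>P. y p t * y' q * K p q)"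
    by (rule DERIV_unique)
  have swap: "(\<Sum>p\<in>P. \<Sum>q\<in>P. y' p * y q t * K p q) = (\<Sum>p\<in>P. \<Sum>q\<in>P. y p t * y' q * K p q)"
    by (subst sum.swap) (auto intro!: sum.cong simp: K)
  have "((\<lambda>s. 1 / 2 * (\<Sum>p\<in>P. \<Sum>q\<in>P. y p s * y q s * K p q)) has_real_derivative
      1 / 2 * (\<Sum>p\<in>P. \<Sum>q\<in>P. (y' p * y q t + y' q * y p t) * K p q)) (at t)"
    by (intro DERIV_sum DERIV_cmult_right DERIV_cmult DERIV_mult y)
  also have "1 / 2 * (\<Sum>p\<in>P. \<Sum>q\<in>P. (y' p * y q t + y' q * y p t) * K p q) = A'"
    using swap by (simp add: A' distrib_right sum.distrib mult.commute[of "y' _" "y _ _"])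
  finally show ?thesis
    by (rule has_field_derivative_transform_within_open[OF _ S])
      (simp add: hartree_energy_eq hartree_potential_expand[OF f _ _ \<rho> \<rho>] K_def)
qed

lemma ks_density_eq: "ks_density X r = 2 * (\<Sum>i\<in>UNIV. rep_L2 (X $ i) r * rep_L2 (X $ i) r)"
  by (simp add: ks_density_def power2_eq_square)

lemma ks_density_measurable [measurable]: "ks_density X \<in> borel_measurable borel"
  unfolding ks_density_eq[abs_def] by measurable

lemma kinetic_energy_eq:
  "(LINT r|lborel. (\<Sum>k\<in>UNIV. (rep_L2 (g $ k) r)\<^sup>2)) = inner g g" for g :: "L2^3"
  using sq_integrable_mult[OF sq_integrable_rep sq_integrable_rep]
  by (simp add: inner_vec_def inner_L2_eq power2_eq_square Bochner_Integration.integral_sum)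

text \<open>The parameter \<open>N\<close> carries only the index type of the tuples, on which the
  assumption \<open>xc\<close> depends through the set of densities.\<close>

locale kohn_sham =
  fixes V :: "L2 set" and Vext :: "real^3 \<Rightarrow> real"
    and \<epsilon>xc vxc :: "(real^3 \<Rightarrow> real) \<Rightarrow> real^3 \<Rightarrow> real" and N :: "'n::finite itself"
  assumes V_H1: "V \<subseteq> H1" and subspace_V: "subspace V"
    and finite_dimensional: "\<exists>B. finite B \<and> span B = V"
    and ext: "\<forall>u\<in>V. \<forall>v\<in>V. integrable lborel (\<lambda>r. Vext r * rep_L2 u r * rep_L2 v r)"
    and xc: "has_xc_potential (ks_density ` (tuples V :: (L2^'n) set)) \<epsilon>xc vxc"
begin

lemma obtain_orthogonal_basis: obtains C where "orthogonal_basis V C"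
proof -
  obtain B where B: "finite B" "span B = V" using finite_dimensional by blast
  obtain C where C: "finite C" "span C = span B" "\<And>v. v \<in> span B \<Longrightarrow> v = (\<Sum>c\<in>C. coord c v *\<^sub>R c)"
    using orthogonal_basis_exists[OF B(1)] by blast
  have "orthogonal_basis V C"
    using C B subspace_V span_superset[of C] by unfold_locales auto
  then show ?thesis by (rule that)
qed

lemma coulomb_bounded_mult: "u \<in> V \<Longrightarrow> v \<in> V \<Longrightarrow> coulomb_bounded (\<lambda>r. rep_L2 u r * rep_L2 v r)"
  using V_H1 by (auto intro: coulomb_bounded_H1_mult)

lemma coulomb_bounded_ks_density: "X \<in> tuples V \<Longrightarrow> coulomb_bounded (ks_density X)"
  unfolding ks_density_eq[abs_def]
  by (intro coulomb_bounded_cmult coulomb_bounded_sum coulomb_bounded_mult) (auto simp: tuples_def)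

lemma admissible_Vext: "admissible_weight V Vext"
  using ext by (simp add: admissible_weight_def)

lemma admissible_hartree: "X \<in> tuples V \<Longrightarrow> admissible_weight V (hartree_potential (ks_density X))"
  unfolding admissible_weight_def mult.assoc
  by (intro ballI integrable_mult_hartree_potential coulomb_bounded_ks_density coulomb_boundedD(2) coulomb_bounded_mult)

text \<open>The density of a tuple with all entries equal to \<open>u\<close> is a multiple of \<open>u\<^sup>2\<close>; mixed products
  follow by polarization.\<close>

lemma admissible_vxc:
  fixes X :: "L2^'n"
  assumes X: "X \<in> tuples V"
  shows "admissible_weight V (vxc (ks_density X))"
  unfolding admissible_weight_def
proof (intro ballI)
  let ?W = "vxc (ks_density X)"
  have W [measurable]: "?W \<in> borel_measurable borel"
    using xc X by (auto simp: has_xc_potential_def)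
  have sq: "integrable lborel (\<lambda>r. ?W r * (rep_L2 w r)\<^sup>2)" if "w \<in> V" for w
  proof -
    have "(\<chi> i. w :: L2^'n) \<in> tuples V" using that by (simp add: tuples_def)
    then have "integrable lborel (\<lambda>r. ?W r * ks_density (\<chi> i. w :: L2^'n) r)"
      using xc X unfolding has_xc_potential_def by blast
    then have "integrable lborel (\<lambda>r. (2 * real CARD('n)) * (?W r * (rep_L2 w r)\<^sup>2))"
      by (simp add: ks_density_def ac_simps)
    then show ?thesis by simp
  qed
  fix u v assume uv: "u \<in> V" "v \<in> V"
  have "integrable lborel (\<lambda>r. (?W r * (rep_L2 (u + v) r)\<^sup>2 - ?W r * (rep_L2 u r)\<^sup>2 - ?W r * (rep_L2 v r)\<^sup>2) / 2)"
    by (intro Bochner_Integration.integrable_diff integrable_divide sq uv subspace_add[OF subspace_V])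
  then show "integrable lborel (\<lambda>r. ?W r * rep_L2 u r * rep_L2 v r)"
    by (rule iffD1[OF integrable_cong_AE, rotated -1])
      (measurable, use rep_L2_add[of u v] in \<open>eventually_elim, simp add: power2_sum algebra_simps\<close>)
qed

lemma integral_weight_density:
  assumes W: "admissible_weight V W" and X: "X \<in> tuples V"
  shows "(LINT r|lborel. W r * ks_density X r) = 2 * (\<Sum>i\<in>UNIV. weight_form W (X $ i) (X $ i))"
proof -
  have "integrable lborel (\<lambda>r. W r * rep_L2 (X $ i) r * rep_L2 (X $ i) r)" for i
    using W X by (auto simp: admissible_weight_def tuples_def)
  moreover have "W r * ks_density X r = 2 * (\<Sum>i\<in>UNIV. W r * rep_L2 (X $ i) r * rep_L2 (X $ i) r)" for r
    by (simp add: ks_density_eq sum_distrib_left ac_simps)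
  ultimately show ?thesis
    by (simp only: integral_mult_right_zero weight_form_def Bochner_Integration.integral_sum)
qed

text \<open>The right-hand side of the equation for the gradient as a form in two functions, with
  the density frozen at \<open>X\<close>. Its symmetry in \<open>u\<close> and \<open>v\<close> is
  the source of the symmetric matrix \<open>gram X (ks_gradient V Vext vxc X)\<close>.\<close>

definition energy_form :: "L2^'n \<Rightarrow> L2 \<Rightarrow> L2 \<Rightarrow> real" where
  "energy_form X u v = 4 * (1 / 2 * inner (weak_gradient u) (weak_gradient v)
     + weight_form Vext u v + weight_form (hartree_potential (ks_density X)) u v
     + weight_form (vxc (ks_density X)) u v)"

lemma energy_form_commute: "energy_form X u v = energy_form X v u"
  by (simp add: energy_form_def weight_form_commute[of _ u v] inner_commute)

lemma ks_gradient_spec: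
  fixes X :: "L2^'n"
  assumes X: "X \<in> tuples V"
  shows "ks_gradient V Vext vxc X \<in> tuples V"
    and "v \<in> V \<Longrightarrow> inner (ks_gradient V Vext vxc X $ i) v = energy_form X (X $ i) v"
proof -
  obtain C where "orthogonal_basis V C" by (rule obtain_orthogonal_basis)
  then interpret orthogonal_basis V C .
  have "linear_form_on V (energy_form X (X $ i))" for i
    unfolding energy_form_def
    using X by (intro linear_form_on_cmult linear_form_on_add inner_weak_gradient_linear[OF V_H1]
        weight_form_linear admissible_Vext admissible_hartree admissible_vxc subspace_V)
      (auto simp: tuples_def)
  then have ex1: "\<exists>!g. g \<in> V \<and> (\<forall>v\<in>V. inner g v = energy_form X (X $ i) v)" for i
    by (rule riesz_representation)
  then obtain g where g: "\<And>i. g i \<in> V" "\<And>i v. v \<in> V \<Longrightarrow> inner (g i) v = energy_form X (X $ i) v"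
    by metis
  let ?P = "\<lambda>G. G \<in> tuples V \<and> (\<forall>i. \<forall>v\<in>V. inner (G $ i) v = energy_form X (X $ i) v)"
  have "\<exists>!G. ?P G"
  proof (rule ex1I)
    show "?P (\<chi> i. g i)" using g by (simp add: tuples_def)
    fix G assume G: "?P G"
    have "G $ i = g i" for i
      using G g ex1[of i] unfolding tuples_def by blast
    then show "G = (\<chi> i. g i)" by (simp add: vec_eq_iff)
  qed
  from theI'[OF this] have "?P (ks_gradient V Vext vxc X)"
    unfolding ks_gradient_def energy_form_def weight_form_def .
  then show "ks_gradient V Vext vxc X \<in> tuples V"
    and "v \<in> V \<Longrightarrow> inner (ks_gradient V Vext vxc X $ i) v = energy_form X (X $ i) v"
    by blast+
qed

lemma gram_ks_gradient_symmetric: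
  fixes X :: "L2^'n"
  assumes X: "X \<in> tuples V"
  shows "inner (X $ i) (ks_gradient V Vext vxc X $ j) = inner (X $ j) (ks_gradient V Vext vxc X $ i)"
proof -
  have "X $ i \<in> V" "X $ j \<in> V" using X by (auto simp: tuples_def)
  then show ?thesis
    using ks_gradient_spec(2)[OF X, of "X $ i" j] ks_gradient_spec(2)[OF X, of "X $ j" i]
      energy_form_commute[of X "X $ i" "X $ j"]
    by (simp add: inner_commute)
qed

section \<open>Grassmann gradient and Gram matrices\<close>

lemma grassmann_gradient_component:
  "grassmann_gradient V Vext vxc X $ i =
    (\<Sum>j\<in>UNIV. inner (X $ j) (X $ i) *\<^sub>R (ks_gradient V Vext vxc X $ j))
    - (\<Sum>j\<in>UNIV. inner (X $ j) (ks_gradient V Vext vxc X $ i) *\<^sub>R (X $ j))"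
  by (simp add: grassmann_gradient_def tuple_mult_def gram_def)

lemma grassmann_gradient_in_tuples:
  fixes X :: "L2^'n"
  assumes X: "X \<in> tuples V"
  shows "grassmann_gradient V Vext vxc X \<in> tuples V"
  unfolding tuples_def mem_Collect_eq grassmann_gradient_component
  using X ks_gradient_spec(1)[OF X]
  by (intro allI subspace_diff subspace_sum subspace_scale subspace_V) (auto simp: tuples_def)

lemma gram_grassmann_gradient:
  fixes X :: "L2^'n"
  defines "G \<equiv> ks_gradient V Vext vxc X"
  shows "inner (X $ k) (grassmann_gradient V Vext vxc X $ i) =
    (\<Sum>j\<in>UNIV. inner (X $ j) (X $ i) * inner (X $ k) (G $ j) - inner (X $ j) (G $ i) * inner (X $ k) (X $ j))"
  by (simp add: grassmann_gradient_component inner_diff_right inner_sum_right sum_subtractf G_def)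

lemma gram_grassmann_gradient_antisymmetric:
  fixes X :: "L2^'n"
  assumes X: "X \<in> tuples V"
  shows "inner (X $ k) (grassmann_gradient V Vext vxc X $ i) + inner (X $ i) (grassmann_gradient V Vext vxc X $ k) = 0"
  unfolding gram_grassmann_gradient sum.distrib[symmetric]
proof (intro sum.neutral ballI)
  \<comment> \<open>The commutator and its transpose are sums over the same index, and after the
    symmetries of both Gram matrices are used the terms cancel for each \<open>j\<close>
    separately.\<close>
  fix j
  let ?G = "ks_gradient V Vext vxc X"
  show "inner (X $ j) (X $ i) * inner (X $ k) (?G $ j) - inner (X $ j) (?G $ i) * inner (X $ k) (X $ j)
      + (inner (X $ j) (X $ k) * inner (X $ i) (?G $ j) - inner (X $ j) (?G $ k) * inner (X $ i) (X $ j)) = 0"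
    unfolding gram_ks_gradient_symmetric[OF X, of j i] gram_ks_gradient_symmetric[OF X, of j k]
      inner_commute[of "X $ k" "X $ j"] inner_commute[of "X $ i" "X $ j"]
    by (simp add: algebra_simps)
qed

text \<open>On the Stiefel manifold the Grassmann gradient is the orthogonal projection of the gradient
  onto the complement of the span of the tuple.\<close>

lemma norm_grassmann_gradient:
  fixes X :: "L2^'n"
  assumes X: "X \<in> tuples V" and orth: "gram X X = mat 1"
  shows "(norm (grassmann_gradient V Vext vxc X))\<^sup>2 =
    inner (ks_gradient V Vext vxc X) (grassmann_gradient V Vext vxc X)"
proof -
  let ?G = "ks_gradient V Vext vxc X" and ?D = "grassmann_gradient V Vext vxc X"
  have o: "inner (X $ i) (X $ j) = (if i = j then 1 else 0)" for i j
    using arg_cong[OF orth, of "\<lambda>A. A $ i $ j"] by (simp add: gram_def mat_def)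
  have comp: "?D $ i = ?G $ i - (\<Sum>j\<in>UNIV. inner (X $ j) (?G $ i) *\<^sub>R (X $ j))" for i
    unfolding grassmann_gradient_component o by (simp add: if_distrib[of "\<lambda>x. x *\<^sub>R _"] cong: if_cong)
  have "inner (X $ k) (?D $ i) = 0" for k i
    unfolding comp by (simp add: inner_diff_right inner_sum_right o if_distrib[of "\<lambda>x. _ * x"] cong: if_cong)
  then have "inner (?D $ i) (?D $ i) = inner (?G $ i) (?D $ i)" for i
    by (subst (1) comp) (simp add: inner_diff_left inner_sum_left)
  then show ?thesis by (simp add: power2_norm_eq_inner inner_vec_def)
qed

text \<open>All densities over \<open>V\<close> lie, up to null sets, in the span of the finitely
  many products of basis functions; the Hartree and exchange-correlation chain rules are applied to
  this family.\<close>

lemma ks_density_expand: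
  fixes X :: "L2^'n"
  assumes "orthogonal_basis V C" and X: "X \<in> tuples V"
  shows "AE r in lborel. ks_density X r = (\<Sum>p\<in>C \<times> C.
    (2 * (\<Sum>i\<in>UNIV. coord (fst p) (X $ i) * coord (snd p) (X $ i))) * (rep_L2 (fst p) r * rep_L2 (snd p) r))"
proof -
  interpret orthogonal_basis V C by fact
  have "AE r in lborel. rep_L2 (X $ i) r = (\<Sum>c\<in>C. coord c (X $ i) * rep_L2 c r)" for i
  proof -
    have "AE r in lborel. \<forall>c\<in>C. rep_L2 (coord c (X $ i) *\<^sub>R c) r = coord c (X $ i) * rep_L2 c r"
      using finite_C by (intro AE_finite_allI rep_L2_scaleR)
    then have "AE r in lborel. rep_L2 (\<Sum>c\<in>C. coord c (X $ i) *\<^sub>R c) r = (\<Sum>c\<in>C. coord c (X $ i) * rep_L2 c r)"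
      using rep_L2_sum[of "\<lambda>c. coord c (X $ i) *\<^sub>R c" C] by eventually_elim simp
    then show ?thesis
      using expand[of "X $ i"] X by (simp add: tuples_def)
  qed
  then have "AE r in lborel. \<forall>i\<in>UNIV. rep_L2 (X $ i) r = (\<Sum>c\<in>C. coord c (X $ i) * rep_L2 c r)"
    by (intro AE_finite_allI) auto
  then show ?thesis
  proof eventually_elim
    case (elim r)
    have "ks_density X r = 2 * (\<Sum>i\<in>UNIV. \<Sum>c\<in>C. \<Sum>d\<in>C. (coord c (X $ i) * rep_L2 c r) * (coord d (X $ i) * rep_L2 d r))"
      using elim by (simp add: ks_density_eq sum_product)
    also have "\<dots> = (\<Sum>i\<in>UNIV. \<Sum>p\<in>C \<times> C.
        2 * (coord (fst p) (X $ i) * coord (snd p) (X $ i) * (rep_L2 (fst p) r * rep_L2 (snd p) r)))"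
      by (simp add: sum.cartesian_product sum_distrib_left case_prod_unfold ac_simps)
    also have "\<dots> = (\<Sum>p\<in>C \<times> C. \<Sum>i\<in>UNIV.
        2 * (coord (fst p) (X $ i) * coord (snd p) (X $ i) * (rep_L2 (fst p) r * rep_L2 (snd p) r)))"
      by (rule sum.swap)
    finally show ?case
      by (simp add: sum_distrib_left sum_distrib_right mult.assoc)
  qed
qed

lemma has_real_derivative_ks_energy:
  fixes U :: "real \<Rightarrow> L2^'n"
  assumes S: "open S" "t \<in> S" and U: "\<And>s. s \<in> S \<Longrightarrow> U s \<in> tuples V"
    and U': "(U has_vector_derivative U') (at t)" "U' \<in> tuples V"
  shows "((\<lambda>s. ks_energy Vext \<epsilon>xc (U s)) has_real_derivative inner (ks_gradient V Vext vxc (U t)) U') (at t)"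
proof -
  obtain C where C: "orthogonal_basis V C" by (rule obtain_orthogonal_basis)
  then interpret orthogonal_basis V C .
  define y where "y p s = 2 * (\<Sum>i\<in>UNIV. coord (fst p) (U s $ i) * coord (snd p) (U s $ i))" for p s
  define y' where "y' p = 2 * (\<Sum>i\<in>UNIV. coord (fst p) (U' $ i) * coord (snd p) (U t $ i)
      + coord (snd p) (U' $ i) * coord (fst p) (U t $ i))" for p
  define f where "f p r = rep_L2 (fst p) r * rep_L2 (snd p) r" for p :: "L2 \<times> L2" and r
  let ?\<rho> = "\<lambda>s. ks_density (U s)"
  have Ui: "U s $ i \<in> V" if "s \<in> S" for s i using U[OF that] by (simp add: tuples_def)
  have Ui': "U' $ i \<in> V" for i using U'(2) by (simp add: tuples_def)
  have nth: "((\<lambda>s. U s $ i) has_vector_derivative U' $ i) (at t)" for i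
    by (rule has_vector_derivative_vec_nth[OF U'(1)])
  have f: "coulomb_bounded (f p)" if "p \<in> C \<times> C" for p
    unfolding f_def using that C_subset by (intro coulomb_bounded_mult) auto
  have y: "(y p has_real_derivative y' p) (at t)" for p
    unfolding y_def y'_def by (intro DERIV_cmult DERIV_sum DERIV_mult coord_deriv nth)
  have \<rho>: "AE r in lborel. ?\<rho> s r = (\<Sum>p\<in>C \<times> C. y p s * f p r)" if "s \<in> S" for s
    unfolding y_def f_def by (rule ks_density_expand[OF C U[OF that]])
  \<comment> \<open>The 4 is one factor 2 from the density and one from differentiating a quadratic
    form. Here \<open>W\<close> does not vary with \<open>s\<close>; for the nonlinear terms it is
    the potential frozen at time \<open>t\<close>.\<close>
  have weight: "((\<lambda>s. LINT r|lborel. W r * ?\<rho> s r) has_real_derivative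
      4 * (\<Sum>i\<in>UNIV. weight_form W (U t $ i) (U' $ i))) (at t)" if W: "admissible_weight V W" for W
  proof -
    have "((\<lambda>s. 2 * (\<Sum>i\<in>UNIV. weight_form W (U s $ i) (U s $ i))) has_real_derivative
        2 * (\<Sum>i\<in>UNIV. 2 * weight_form W (U t $ i) (U' $ i))) (at t)"
      by (intro DERIV_cmult DERIV_sum quadratic_form_deriv[OF _ weight_form_commute nth Ui' S Ui]
          weight_form_linear[OF W subspace_V])
    then have "((\<lambda>s. 2 * (\<Sum>i\<in>UNIV. weight_form W (U s $ i) (U s $ i))) has_real_derivative
        4 * (\<Sum>i\<in>UNIV. weight_form W (U t $ i) (U' $ i))) (at t)"
      by (simp add: sum_distrib_left)
    then show ?thesis
      by (rule has_field_derivative_transform_within_open[OF _ S])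
        (simp add: integral_weight_density[OF W U])
  qed
  \<comment> \<open>The factor 2 agrees with \<open>4 * (1 / 2)\<close> in
    \<open>energy_form\<close>.\<close>
  have kin: "((\<lambda>s. \<Sum>i\<in>UNIV. LINT r|lborel. (\<Sum>k\<in>UNIV. (rep_L2 (weak_gradient (U s $ i) $ k) r)\<^sup>2))
      has_real_derivative (\<Sum>i\<in>UNIV. 2 * inner (weak_gradient (U t $ i)) (weak_gradient (U' $ i)))) (at t)"
    unfolding kinetic_energy_eq
    by (intro DERIV_sum quadratic_form_deriv[where Q="\<lambda>u v. inner (weak_gradient u) (weak_gradient v)", OF _ inner_commute nth Ui' S Ui]
        inner_weak_gradient_linear[OF V_H1])
  have hartree: "((\<lambda>s. hartree_energy (?\<rho> s)) has_real_derivative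
      4 * (\<Sum>i\<in>UNIV. weight_form (hartree_potential (?\<rho> t)) (U t $ i) (U' $ i))) (at t)"
    by (rule has_real_derivative_hartree_energy[where \<rho>="?\<rho>", OF f S ks_density_measurable \<rho> y weight])
      (assumption | rule admissible_hartree[OF U[OF S(2)]])+
  \<comment> \<open>The coefficients control the density in the \<open>L\<^sup>1\<close> norm, which
    is the norm of the exchange-correlation derivative.\<close>
  have lip: "(LINT r|lborel. \<bar>?\<rho> s r - ?\<rho> t r\<bar>) \<le> (\<Sum>p\<in>C \<times> C. \<bar>y p s - y p t\<bar> * (LINT r|lborel. \<bar>f p r\<bar>))"
    if s: "s \<in> S" for s
  proof -
    have fint: "integrable lborel (\<lambda>r. \<bar>y p s - y p t\<bar> * \<bar>f p r\<bar>)" if "p \<in> C \<times> C" for p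
      using coulomb_boundedD(2)[OF f[OF that]] by simp
    have "(LINT r|lborel. \<bar>?\<rho> s r - ?\<rho> t r\<bar>) \<le> (LINT r|lborel. (\<Sum>p\<in>C \<times> C. \<bar>y p s - y p t\<bar> * \<bar>f p r\<bar>))"
    proof (rule integral_mono_AE)
      show "integrable lborel (\<lambda>r. \<bar>?\<rho> s r - ?\<rho> t r\<bar>)"
        by (intro integrable_abs Bochner_Integration.integrable_diff coulomb_boundedD(2) coulomb_bounded_ks_density U s S)
      show "integrable lborel (\<lambda>r. \<Sum>p\<in>C \<times> C. \<bar>y p s - y p t\<bar> * \<bar>f p r\<bar>)"
        by (rule Bochner_Integration.integrable_sum[OF fint])
      show "AE r in lborel. \<bar>?\<rho> s r - ?\<rho> t r\<bar> \<le> (\<Sum>p\<in>C \<times> C. \<bar>y p s - y p t\<bar> * \<bar>f p r\<bar>)"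
        using \<rho>[OF s] \<rho>[OF S(2)]
      proof eventually_elim
        case (elim r)
        have "?\<rho> s r - ?\<rho> t r = (\<Sum>p\<in>C \<times> C. (y p s - y p t) * f p r)"
          by (simp add: elim left_diff_distrib sum_subtractf)
        then show ?case by (simp only: abs_mult[symmetric] sum_abs)
      qed
    qed
    also have "\<dots> = (\<Sum>p\<in>C \<times> C. \<bar>y p s - y p t\<bar> * (LINT r|lborel. \<bar>f p r\<bar>))"
      by (subst Bochner_Integration.integral_sum[OF fint]) simp_all
    finally show ?thesis .
  qed
  have xc': "((\<lambda>s. xc_energy \<epsilon>xc (?\<rho> s)) has_real_derivative
      4 * (\<Sum>i\<in>UNIV. weight_form (vxc (?\<rho> t)) (U t $ i) (U' $ i))) (at t)"
    by (rule has_real_derivative_xc_energy[where \<rho>="?\<rho>", OF xc S _ lip _ y weight])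
      (use U admissible_vxc[OF U[OF S(2)]] in auto)
  have "inner (ks_gradient V Vext vxc (U t)) U' = (\<Sum>i\<in>UNIV. energy_form (U t) (U t $ i) (U' $ i))"
    using ks_gradient_spec(2)[OF U[OF S(2)] Ui'] by (simp add: inner_vec_def)
  also have "\<dots> = (\<Sum>i\<in>UNIV. 2 * inner (weak_gradient (U t $ i)) (weak_gradient (U' $ i)))
      + 4 * (\<Sum>i\<in>UNIV. weight_form Vext (U t $ i) (U' $ i))
      + 4 * (\<Sum>i\<in>UNIV. weight_form (hartree_potential (?\<rho> t)) (U t $ i) (U' $ i))
      + 4 * (\<Sum>i\<in>UNIV. weight_form (vxc (?\<rho> t)) (U t $ i) (U' $ i))"
    by (simp add: energy_form_def sum.distrib sum_distrib_left algebra_simps)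
  finally have eq: "inner (ks_gradient V Vext vxc (U t)) U' = \<dots>" .
  show ?thesis
    unfolding ks_energy_def eq by (intro DERIV_add kin weight[OF admissible_Vext] hartree xc')
qed

text \<open>The entries of the Gram matrix have derivative 0 at positive times by the antisymmetry,
  and the continuity of \<open>U\<close> on the closed half-line ties them to their values at time
  0.\<close>

lemma gram_constant:
  fixes U :: "real \<Rightarrow> L2^'n"
  assumes U_in: "\<forall>t\<ge>0. U t \<in> tuples V" and U_cont: "continuous_on {0..} U"
    and flow: "\<forall>t>0. (U has_vector_derivative - grassmann_gradient V Vext vxc (U t)) (at t)"
    and t: "0 \<le> t"
  shows "gram (U t) (U t) = gram (U 0) (U 0)"
proof -
  have "inner (U t $ k) (U t $ i) = inner (U 0 $ k) (U 0 $ i)" for k i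
  proof (cases "t = 0")
    case False
    with t have "0 < t" by simp
    then show ?thesis
    proof (rule DERIV_isconst_end)
      show "continuous_on {0..t} (\<lambda>s. inner (U s $ k) (U s $ i))"
        by (intro continuous_intros continuous_on_subset[OF U_cont]) auto
      fix s :: real assume s: "0 < s" "s < t"
      let ?D = "grassmann_gradient V Vext vxc (U s)"
      have nth: "((\<lambda>s. U s $ j) has_vector_derivative (- ?D) $ j) (at s)" for j
        using flow s by (intro has_vector_derivative_vec_nth) auto
      have "((\<lambda>s. inner (U s $ k) (U s $ i)) has_vector_derivative
          inner (U s $ k) ((- ?D) $ i) + inner ((- ?D) $ k) (U s $ i)) (at s)"
        by (rule bounded_bilinear.has_vector_derivative[OF bounded_bilinear_inner nth nth])
      moreover have "inner (U s $ k) ((- ?D) $ i) + inner ((- ?D) $ k) (U s $ i) = 0"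
        using gram_grassmann_gradient_antisymmetric[of "U s" k i] U_in s
        by (simp add: inner_commute[of "?D $ k"])
      ultimately show "((\<lambda>s. inner (U s $ k) (U s $ i)) has_real_derivative 0) (at s)"
        by (simp add: has_real_derivative_iff_has_vector_derivative)
    qed
  qed simp
  then show ?thesis by (simp add: gram_def vec_eq_iff)
qed

end

theorem proposition3p2:
  fixes V :: "L2 set" and Ng :: nat
    and Vext :: "real^3 \<Rightarrow> real"
    and \<epsilon>xc vxc :: "(real^3 \<Rightarrow> real) \<Rightarrow> real^3 \<Rightarrow> real"
    and U\<^sub>0 :: "L2^'n" and U :: "real \<Rightarrow> L2^'n"
  assumes V_H1: "V \<subseteq> H1"
    and V_subspace: "subspace V"
    and V_dim: "\<exists>B. finite B \<and> independent B \<and> span B = V \<and> card B = Ng"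
    and ext: "\<forall>u\<in>V. \<forall>v\<in>V. integrable lborel (\<lambda>r. Vext r * rep_L2 u r * rep_L2 v r)"
    and xc: "has_xc_potential (ks_density ` (tuples V :: (L2^'n) set)) \<epsilon>xc vxc"
    and init: "U\<^sub>0 \<in> tuples V \<inter> stiefel"
    and U_in: "\<forall>t\<ge>0. U t \<in> tuples V"
    and U_cont: "continuous_on {0..} U"
    and flow: "\<forall>t>0. (U has_vector_derivative - grassmann_gradient V Vext vxc (U t)) (at t)"
    and U_init: "U 0 = U\<^sub>0"
  shows "(\<forall>t\<ge>0. U t \<in> stiefel) \<and>
         (\<forall>t>0. ((\<lambda>s. ks_energy Vext \<epsilon>xc (U s)) has_real_derivative
                    - (norm (grassmann_gradient V Vext vxc (U t)))\<^sup>2) (at t) \<and>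
                 - (norm (grassmann_gradient V Vext vxc (U t)))\<^sup>2 \<le> 0)"
proof -
  interpret kohn_sham V Vext \<epsilon>xc vxc "TYPE('n)"
    using V_H1 V_subspace V_dim ext xc by unfold_locales auto
  have orth: "gram (U t) (U t) = mat 1" if "0 \<le> t" for t
    using gram_constant[OF U_in U_cont flow that] init by (simp add: U_init stiefel_def)
  have "U t \<in> stiefel" if "0 \<le> t" for t
    using orth[OF that] U_in V_H1 that by (auto simp: stiefel_def tuples_def)
  moreover have "((\<lambda>s. ks_energy Vext \<epsilon>xc (U s)) has_real_derivative
      - (norm (grassmann_gradient V Vext vxc (U t)))\<^sup>2) (at t)" if t: "0 < t" for t
  proof -
    have D: "- grassmann_gradient V Vext vxc (U t) \<in> tuples V"
      using grassmann_gradient_in_tuples[of "U t"] U_in t subspace_neg[OF V_subspace] by (auto simp: tuples_def)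
    have "((\<lambda>s. ks_energy Vext \<epsilon>xc (U s)) has_real_derivative
      inner (ks_gradient V Vext vxc (U t)) (- grassmann_gradient V Vext vxc (U t))) (at t)"
      by (rule has_real_derivative_ks_energy[where S="{0<..}"]) (use U_in flow t D in auto)
    then show ?thesis
      using norm_grassmann_gradient[of "U t"] orth U_in t by simp
  qed
  ultimately show ?thesis by simp
qed

end
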